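(* Let $a,b$ be positive integers. For a position $(x,y)$ of $\mathrm{WYT}(a,b)$, the remoteness value $\mathcal{R}(x,y)$ can be computed in time polynomial in $a$, $b$ and $\log(xy)$.
   Context: Game $\mathrm{WYT}(a,b)$: positions are pairs $(x,y)$ of nonnegative integers; a move replaces $(x,y)$ by $(x-\epsilon,y-\delta)$ where $0\le\epsilon\le x$, $0\le\delta\le y$, $\epsilon+\delta>0$, and $|\epsilon-\delta|<a$ or $\min(\epsilon,\delta)<b$. A player unable to move loses. Remoteness function: $\mathcal{R}(p)=0$ if $p$ is terminal; otherwise, if some move $p\to q$ has $\mathcal{R}(q)$ even, $\mathcal{R}(p)=1+\min\{\mathcal{R}(q): p\to q,\ \mathcal{R}(q)\text{ even}\}$, else $\mathcal{R}(p)=1+\max\{\mathcal{R}(q): p\to q\}$. *)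

theory Defs
  imports Complex_Main "HOL-Library.Log_Nat"
begin

section \<open>The game and its remoteness function\<close>

definition wyt_moves :: "nat \<Rightarrow> nat \<Rightarrow> nat \<times> nat \<Rightarrow> (nat \<times> nat) set" where
  "wyt_moves a b p =
     {(fst p - e, snd p - d) | e d.
        e \<le> fst p \<and> d \<le> snd p \<and> e + d > 0 \<and>
        (\<bar>int e - int d\<bar> < int a \<or> min e d < b)}"

lemma wyt_moves_decreasing:
  "q \<in> wyt_moves a b p \<Longrightarrow> fst q + snd q < fst p + snd p"
  by (auto simp: wyt_moves_def)

lemma finite_wyt_moves: "finite (wyt_moves a b p)"
proof (rule finite_subset)
  show "wyt_moves a b p \<subseteq> {..fst p} \<times> {..snd p}"
    by (auto simp: wyt_moves_def)
qed simp

text \<open>The remoteness of a position, given the set \<open>V\<close> of remoteness values of its options.\<close>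

definition remoteness_step :: "nat set \<Rightarrow> nat" where
  "remoteness_step V =
     (if V = {} then 0
      else if \<exists>v\<in>V. even v then 1 + Min {v \<in> V. even v}
      else 1 + Max V)"

function remoteness :: "nat \<Rightarrow> nat \<Rightarrow> nat \<times> nat \<Rightarrow> nat" where
  "remoteness a b p = remoteness_step (remoteness a b ` wyt_moves a b p)"
  by pat_completeness auto
termination
  by (relation "measure (\<lambda>(a, b, p). fst p + snd p)") (auto dest: wyt_moves_decreasing)

declare remoteness.simps [simp del]


section \<open>The machine model: random access machines with logarithmic cost\<close>

text \<open>
  Polynomial time refers to the random access machine of Aho, Hopcroft and Ullman under the
  logarithmic cost criterion, which is polynomially equivalent to multi-tape Turing machines.
  Memory cells hold natural numbers, addresses may be direct or indirect, and the cost of an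
  operation is the total binary length of all numbers involved, addresses included. Control
  flow is structured (conditionals and loops) instead of using jumps. Every program is a
  finite object, independent of its input.
\<close>

type_synonym memory = "nat \<Rightarrow> nat"

datatype loc = Direct nat | Indirect nat

datatype operand = Const nat | Cell loc

datatype arith_op = Plus | Monus | Times | Div

datatype prog =
    Skip
  | Assign loc arith_op operand operand
  | Seq prog prog
  | If operand prog prog
  | While operand prog

text \<open>Length of the binary numeral of \<open>n\<close>; the numeral of \<open>0\<close> has length \<open>1\<close>.\<close>

definition bit_len :: "nat \<Rightarrow> nat" where
  "bit_len n = max 1 (floorlog 2 n)"

fun address :: "memory \<Rightarrow> loc \<Rightarrow> nat" where
  "address m (Direct i) = i"
| "address m (Indirect i) = m i"

fun address_cost :: "memory \<Rightarrow> loc \<Rightarrow> nat" where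
  "address_cost m (Direct i) = bit_len i"
| "address_cost m (Indirect i) = bit_len i + bit_len (m i)"

fun operand_val :: "memory \<Rightarrow> operand \<Rightarrow> nat" where
  "operand_val m (Const n) = n"
| "operand_val m (Cell l) = m (address m l)"

fun operand_cost :: "memory \<Rightarrow> operand \<Rightarrow> nat" where
  "operand_cost m (Const n) = bit_len n"
| "operand_cost m (Cell l) = address_cost m l + bit_len (m (address m l))"

text \<open>Subtraction is truncated at \<open>0\<close>, and division by \<open>0\<close> yields \<open>0\<close>.\<close>

fun apply_op :: "arith_op \<Rightarrow> nat \<Rightarrow> nat \<Rightarrow> nat" where
  "apply_op Plus u v = u + v"
| "apply_op Monus u v = u - v"
| "apply_op Times u v = u * v"
| "apply_op Div u v = u div v"

text \<open>
  \<open>runs c m m' t\<close>: started in memory \<open>m\<close>, the program \<open>c\<close> halts in memory \<open>m'\<close> after time \<open>t\<close>.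
  Tests hold iff the operand is positive.
\<close>

inductive runs :: "prog \<Rightarrow> memory \<Rightarrow> memory \<Rightarrow> nat \<Rightarrow> bool" where
  Skip: "runs Skip m m 1"
| Assign: "runs (Assign l f u v) m
     (m(address m l := apply_op f (operand_val m u) (operand_val m v)))
     (address_cost m l + operand_cost m u + operand_cost m v)"
| Seq: "runs c1 m m1 t1 \<Longrightarrow> runs c2 m1 m2 t2 \<Longrightarrow> runs (Seq c1 c2) m m2 (t1 + t2)"
| IfTrue: "operand_val m u > 0 \<Longrightarrow> runs c1 m m1 t \<Longrightarrow>
     runs (If u c1 c2) m m1 (operand_cost m u + t)"
| IfFalse: "operand_val m u = 0 \<Longrightarrow> runs c2 m m2 t \<Longrightarrow>
     runs (If u c1 c2) m m2 (operand_cost m u + t)"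
| WhileFalse: "operand_val m u = 0 \<Longrightarrow> runs (While u c) m m (operand_cost m u)"
| WhileTrue: "operand_val m u > 0 \<Longrightarrow> runs c m m1 t1 \<Longrightarrow> runs (While u c) m1 m2 t2 \<Longrightarrow>
     runs (While u c) m m2 (operand_cost m u + t1 + t2)"

inductive_cases SkipE: "runs Skip m m' t"
inductive_cases AssignE: "runs (Assign l f u v) m m' t"
inductive_cases SeqE: "runs (Seq c1 c2) m m' t"
inductive_cases IfE: "runs (If u c1 c2) m m' t"
inductive_cases WhileE: "runs (While u c) m m' t"

lemma runs_deterministic:
  "runs c m m1 t1 \<Longrightarrow> runs c m m2 t2 \<Longrightarrow> m2 = m1 \<and> t2 = t1"
proof (induction arbitrary: m2 t2 rule: runs.induct)
  case (Skip m)
  then show ?case by (auto elim: SkipE)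
next
  case (Assign l f u v m)
  then show ?case by (auto elim: AssignE)
next
  case (Seq c1 m m1 t1 c2 m3 t3)
  from Seq.prems show ?case
  proof (rule SeqE)
    fix n s1 s2
    assume *: "runs c1 m n s1" "runs c2 n m2 s2" "t2 = s1 + s2"
    have "n = m1 \<and> s1 = t1" by (rule Seq.IH(1)[OF *(1)])
    with * Seq.IH(2)[of m2 s2] show ?thesis by simp
  qed
next
  case (IfTrue m u c1 m1 t c2)
  from IfTrue.prems show ?case
    by (rule IfE) (use IfTrue.hyps(1) IfTrue.IH in simp_all)
next
  case (IfFalse m u c2 m1 t c1)
  from IfFalse.prems show ?case
    by (rule IfE) (use IfFalse.hyps(1) IfFalse.IH in simp_all)
next
  case (WhileFalse m u c)
  from WhileFalse.prems show ?case
    by (rule WhileE) (use WhileFalse.hyps in simp_all)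
next
  case (WhileTrue m u c m1 t1 m3 t3)
  from WhileTrue.prems show ?case
  proof (rule WhileE)
    assume "operand_val m u = 0"
    with WhileTrue.hyps(1) show ?thesis by simp
  next
    fix n s1 s2
    assume *: "runs c m n s1" "runs (While u c) n m2 s2" "t2 = operand_cost m u + s1 + s2"
    have "n = m1 \<and> s1 = t1" by (rule WhileTrue.IH(1)[OF *(1)])
    with * WhileTrue.IH(2)[of m2 s2] show ?thesis by simp
  qed
qed

text \<open>The inputs are placed in the first cells; all other cells are \<open>0\<close>.\<close>

definition init_memory :: "nat list \<Rightarrow> memory" where
  "init_memory xs i = (if i < length xs then xs ! i else 0)"

text \<open>The output is read from cell \<open>0\<close>.\<close>

definition computes_within :: "prog \<Rightarrow> nat list \<Rightarrow> nat \<Rightarrow> real \<Rightarrow> bool" where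
  "computes_within c inputs result T \<longleftrightarrow>
     (\<exists>m t. runs c (init_memory inputs) m t \<and> m 0 = result \<and> real t \<le> T)"


section \<open>Polynomials in three variables\<close>

definition poly3 :: "nat \<Rightarrow> (nat \<Rightarrow> nat \<Rightarrow> nat \<Rightarrow> real) \<Rightarrow> real \<Rightarrow> real \<Rightarrow> real \<Rightarrow> real" where
  "poly3 D c u v w = (\<Sum>i\<le>D. \<Sum>j\<le>D. \<Sum>k\<le>D. c i j k * u ^ i * v ^ j * w ^ k)"

text \<open>
  \<open>log (xy)\<close> is undefined if a coordinate is \<open>0\<close>; such a coordinate is replaced by \<open>1\<close>.
\<close>

definition log_size :: "nat \<Rightarrow> nat \<Rightarrow> real" where
  "log_size x y = log 2 (real (max 1 x * max 1 y))"

end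

theory Submission
  imports Defs
begin

text \<open>
  The positions of even remoteness are \<open>(x\<^sub>n, y\<^sub>n)\<close> and its mirror image, with remoteness
  \<open>2 n\<close>, where \<open>y\<^sub>n = x\<^sub>n + a n\<close> and the gaps of \<open>x\<close> are \<open>b + c\<^sub>n\<close>. If \<open>y\<^sub>j\<close> sits at offset
  \<open>c > 0\<close> in its gap of \<open>x\<close>, then the next \<open>x\<close> is \<open>y\<^sub>j + b\<close>, while \<open>y\<close> advances by \<open>a + b + c\<^sub>j\<close>.
  Hence the letter \<open>c\<^sub>j\<close> is responsible for \<open>(a + c\<^sub>j - 1) div b\<close> empty gaps followed by one gap
  with letter \<open>(a + c\<^sub>j - 1) mod b + 1\<close>: the word \<open>c\<close> is the fixed point of \<open>u \<mapsto> 0 \<sigma>(u)\<close> for a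
  morphism \<open>\<sigma>\<close>, so that \<open>c = \<sigma>\<^sup>0(0) \<sigma>\<^sup>1(0) \<sigma>\<^sup>2(0) \<dots>\<close>. The block \<open>\<sigma>\<^sup>k(0)\<close> is a concatenation of
  shorter blocks whose indices are explicit, block lengths double every \<open>b + 1\<close> levels, and
  blocks have closed-form weight. A greedy descent through the blocks therefore finds the largest
  \<open>n\<close> with \<open>x\<^sub>n \<le> v\<close> (or \<open>y\<^sub>n \<le> v\<close>) in polynomial time, and two such searches determine the
  remoteness of every position.
\<close>

section \<open>The gap word\<close>

locale wyt =
  fixes a b :: nat
  assumes a_pos: "a > 0" and b_pos: "b > 0"
begin

definition sig :: "nat \<Rightarrow> nat list" where
  "sig c = replicate ((a + c - 1) div b) 0 @ [Suc ((a + c - 1) mod b)]"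

definition subst :: "nat list \<Rightarrow> nat list" where
  "subst u = concat (map sig u)"

definition block :: "nat \<Rightarrow> nat list" where
  "block k = (subst ^^ k) [0]"

definition pref :: "nat \<Rightarrow> nat list" where
  "pref k = concat (map block [0..<k])"

definition plen :: "nat \<Rightarrow> nat" where
  "plen k = length (pref k)"

text \<open>Blocks are nonempty, so \<open>pref (Suc n)\<close> is long enough to have an index
  \<open>n\<close>; by \<open>pref_nth\<close> every other long enough prefix gives the same
  letter.\<close>

definition letter :: "nat \<Rightarrow> nat" where
  "letter n = pref (Suc n) ! n"

definition weight :: "nat list \<Rightarrow> nat" where
  "weight u = (\<Sum>c\<leftarrow>u. b + c)"

definition xs :: "nat \<Rightarrow> nat" where
  "xs n = (\<Sum>i<n. b + letter i)"

definition ys :: "nat \<Rightarrow> nat" where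
  "ys n = xs n + a * n"

lemma subst_simps [simp]: "subst [] = []" "subst (c # u) = sig c @ subst u"
  "subst (u @ v) = subst u @ subst v"
  by (simp_all add: subst_def)

lemma subst_concat: "subst (concat us) = concat (map subst us)"
  by (induction us) auto

lemma block_0 [simp]: "block 0 = [0]"
  by (simp add: block_def)

lemma block_Suc: "block (Suc k) = subst (block k)"
  by (simp add: block_def)

lemma pref_0 [simp]: "pref 0 = []"
  by (simp add: pref_def)

lemma pref_Suc: "pref (Suc k) = pref k @ block k"
  by (simp add: pref_def)

text \<open>Applying \<open>subst\<close> moves every block up by one level, so only
  \<open>block 0\<close> has to be supplied in front. This is the fixed-point equation of the word,
  cut off at a block boundary.\<close>

lemma pref_Suc': "pref (Suc k) = 0 # subst (pref k)"
proof (induction k)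
  case (Suc k)
  have "pref (Suc (Suc k)) = pref (Suc k) @ block (Suc k)"
    by (rule pref_Suc)
  also have "\<dots> = 0 # subst (pref k @ block k)"
    by (simp add: Suc block_Suc)
  finally show ?case by (simp add: pref_Suc)
qed (simp add: pref_Suc)

lemma length_sig: "length (sig c) = Suc ((a + c - 1) div b)"
  by (simp add: sig_def)

lemma length_subst_ge: "length u \<le> length (subst u)"
  by (induction u) (auto simp: length_sig)

lemma length_block_pos: "length (block k) > 0"
proof (induction k)
  case (Suc k)
  then show ?case using length_subst_ge[of "block k"] by (auto simp: block_Suc)
qed simp

lemma plen_0 [simp]: "plen 0 = 0"
  by (simp add: plen_def)

lemma plen_Suc: "plen (Suc k) = plen k + length (block k)"
  by (simp add: plen_def pref_Suc)

lemma length_block: "length (block k) = plen (Suc k) - plen k"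
  by (simp add: plen_Suc)

lemma strict_mono_plen: "strict_mono plen"
  using length_block_pos by (auto simp: strict_mono_Suc_iff plen_Suc)

lemma plen_mono: "k \<le> l \<Longrightarrow> plen k \<le> plen l"
  using strict_mono_plen by (simp add: strict_mono_less_eq)

lemma plen_ge: "k \<le> plen k"
  using strict_mono_plen by (rule strict_mono_imp_increasing)

lemma pref_prefix: "k \<le> l \<Longrightarrow> \<exists>v. pref l = pref k @ v"
proof (induction l rule: dec_induct)
  case (step n)
  then show ?case by (auto simp: pref_Suc)
qed simp

lemma pref_nth: "n < plen k \<Longrightarrow> pref k ! n = letter n"
proof -
  assume n: "n < plen k"
  have n': "n < plen (Suc n)"
    using plen_ge[of "Suc n"] by simp
  show ?thesis
  proof (cases "k \<le> Suc n")
    case True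
    then obtain v where "pref (Suc n) = pref k @ v"
      using pref_prefix by blast
    then show ?thesis using n by (simp add: letter_def nth_append plen_def)
  next
    case False
    then obtain v where "pref k = pref (Suc n) @ v"
      using pref_prefix[of "Suc n" k] by auto
    then show ?thesis using n' by (simp add: letter_def nth_append plen_def)
  qed
qed

lemma pref_eq: "pref k = map letter [0..<plen k]"
  by (rule nth_equalityI) (simp_all add: pref_nth flip: plen_def)

section \<open>Weights of words and of blocks\<close>

lemma weight_simps [simp]: "weight [] = 0" "weight (c # u) = b + c + weight u"
  "weight (u @ v) = weight u + weight v"
  by (simp_all add: weight_def)

lemma weight_replicate [simp]: "weight (replicate n 0) = n * b"
  by (induction n) auto

text \<open>Division of \<open>a + c - 1\<close> by \<open>b\<close> splits the advance of the
  second sequence into gaps of the first: the quotient counts gaps of width \<open>b\<close>, and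
  the last gap has width \<open>b + 1\<close> plus the remainder.\<close>

lemma weight_sig: "weight (sig c) = b + c + a"
proof -
  have "a + c - 1 = (a + c - 1) div b * b + (a + c - 1) mod b"
    by simp
  then show ?thesis
    using a_pos unfolding sig_def by simp
qed

lemma weight_subst: "weight (subst u) = weight u + a * length u"
  by (induction u) (auto simp: weight_sig)

text \<open>Each substitution adds \<open>a\<close> times the current length, and the lengths of the
  blocks below level \<open>k\<close> add up to \<open>plen k\<close>. A table of
  \<open>plen\<close> therefore provides lengths and weights alike.\<close>

lemma weight_block: "weight (block k) = b + a * plen k"
  by (induction k) (auto simp: block_Suc weight_subst plen_Suc algebra_simps)

lemma weight_letters: "weight (map letter [0..<n]) = xs n"
  by (induction n) (auto simp: xs_def)

lemma xs_0 [simp]: "xs 0 = 0"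
  by (simp add: xs_def)

lemma xs_Suc: "xs (Suc n) = xs n + b + letter n"
  by (simp add: xs_def)

lemma ys_0 [simp]: "ys 0 = 0"
  by (simp add: ys_def)

lemma set_subst_le: "c \<in> set (subst u) \<Longrightarrow> c \<le> b"
  using b_pos by (induction u) (auto simp: sig_def Suc_le_eq)

lemma letter_0 [simp]: "letter 0 = 0"
  by (simp add: letter_def pref_Suc')

lemma letter_le: "letter n \<le> b"
proof -
  have "letter n \<in> set (pref (Suc n))"
    unfolding letter_def using plen_ge[of "Suc n"] by (intro nth_mem) (simp add: plen_def)
  then show ?thesis
    using set_subst_le[of _ "pref n"] by (auto simp: pref_Suc')
qed

text \<open>For \<open>c \<le> b\<close> the quotient in \<open>sig c\<close> is at most
  \<open>a\<close>. Together with \<open>plen_Suc_le\<close> this limits how far the last table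
  entry can overshoot the searched value.\<close>

lemma length_subst_le: "(\<And>c. c \<in> set u \<Longrightarrow> c \<le> b) \<Longrightarrow> length (subst u) \<le> (a + 1) * length u"
proof (induction u)
  case (Cons c u)
  have "(a + c - 1) div b \<le> (a * b + (b - 1)) div b"
  proof (rule div_le_mono)
    have "c \<le> b" using Cons.prems by simp
    moreover have "a + b \<le> a * b + 1 + (b - 1)" using a_pos b_pos
      by (cases b; cases a) auto
    ultimately show "a + c - 1 \<le> a * b + (b - 1)" by linarith
  qed
  also have "\<dots> = a" using b_pos by (intro div_nat_eqI) (auto simp: mult.commute)
  finally show ?case using Cons by (auto simp: length_sig)
qed simp

lemma plen_Suc_le: "plen (Suc k) \<le> 1 + (a + 1) * plen k"
proof -
  have "c \<le> b" if "c \<in> set (pref k)" for c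
    using that letter_le by (auto simp: pref_eq)
  then show ?thesis
    using length_subst_le[of "pref k"] by (simp add: plen_def pref_Suc')
qed

text \<open>For \<open>j > 0\<close>, the index \<open>n\<close> such that \<open>xs n < ys j \<le> xs n + b\<close>.\<close>

definition hit :: "nat \<Rightarrow> nat" where
  "hit j = length (subst (map letter [0..<j]))"

section \<open>Images of letters and the place of \<open>ys j\<close> in the gaps of
  \<open>xs\<close>\<close>

lemma hit_0 [simp]: "hit 0 = 0"
  by (simp add: hit_def)

text \<open>This is \<open>pref_Suc'\<close> for prefixes of any length, since \<open>subst\<close>
  maps prefixes to prefixes. The leading letter has index \<open>0\<close>, so the image of letter
  \<open>j\<close> fills the indices from \<open>Suc (hit j)\<close> to
  \<open>hit (Suc j)\<close>.\<close>

lemma subst_letters: "0 # subst (map letter [0..<j]) = map letter [0..<Suc (hit j)]"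
proof -
  obtain v where v: "pref j = map letter [0..<j] @ v"
  proof -
    have "[0..<plen j] = [0..<j] @ [j..<plen j]"
      using plen_ge[of j] upt_add_eq_append[of 0 j "plen j - j"] by simp
    then show ?thesis using that by (simp add: pref_eq)
  qed
  have *: "map letter [0..<plen (Suc j)] = (0 # subst (map letter [0..<j])) @ subst v"
    unfolding pref_eq[symmetric] by (simp add: pref_Suc' v)
  let ?u = "0 # subst (map letter [0..<j])"
  have "?u = take (length ?u) (map letter [0..<plen (Suc j)])"
    unfolding * by simp
  also have "\<dots> = map letter [0..<Suc (hit j)]"
  proof -
    have "length ?u \<le> plen (Suc j)"
      using arg_cong[OF *, of length] by simp
    then show ?thesis by (simp add: take_map hit_def)
  qed
  finally show ?thesis .
qed

text \<open>Take weights in \<open>subst_letters\<close>: the leading letter contributes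
  \<open>b\<close>, and substituting into \<open>j\<close> letters adds \<open>a * j\<close>, which
  turns \<open>xs j\<close> into \<open>ys j\<close>.\<close>

lemma xs_hit: "xs (Suc (hit j)) = ys j + b"
proof -
  have "weight (0 # subst (map letter [0..<j])) = ys j + b"
    by (simp add: weight_subst weight_letters ys_def)
  then show ?thesis
    unfolding subst_letters weight_letters .
qed

lemma hit_Suc: "hit (Suc j) = hit j + length (sig (letter j))"
  by (simp add: hit_def)

lemma letters_sig: "i < length (sig (letter j)) \<Longrightarrow> letter (Suc (hit j + i)) = sig (letter j) ! i"
proof -
  assume i: "i < length (sig (letter j))"
  have "map letter [0..<Suc (hit (Suc j))] = map letter [0..<Suc (hit j)] @ sig (letter j)"
    unfolding subst_letters[symmetric] by simp
  then have "map letter [0..<Suc (hit (Suc j))] ! Suc (hit j + i) = sig (letter j) ! i"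
    by (simp add: nth_append del: upt_Suc)
  moreover have "map letter [0..<Suc (hit (Suc j))] ! Suc (hit j + i) = letter (Suc (hit j + i))"
    using i by (subst nth_map) (auto simp: hit_Suc simp del: upt_Suc)
  ultimately show ?thesis by simp
qed

text \<open>For \<open>j = Suc i\<close>, the index \<open>hit j\<close> is that of the final letter
  of \<open>sig (letter i)\<close>, which is a successor.\<close>

lemma letter_hit_pos: "j > 0 \<Longrightarrow> letter (hit j) > 0"
proof -
  assume "j > 0"
  then obtain i where j: "j = Suc i" by (cases j) auto
  show ?thesis
    using letters_sig[of "length (sig (letter i)) - 1" i]
    by (simp add: j hit_Suc length_sig) (simp add: sig_def nth_append)
qed

text \<open>Only the final letter of an image under \<open>sig\<close> is positive. The least
  \<open>j\<close> with \<open>n \<le> hit j\<close> locates the image that contains index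
  \<open>n\<close>.\<close>

lemma hit_if_letter_pos: "letter n > 0 \<Longrightarrow> \<exists>j. n = hit j"
proof -
  assume pos: "letter n > 0"
  have unb: "j \<le> hit j" for j
    using length_subst_ge[of "map letter [0..<j]"] by (simp add: hit_def)
  have "\<exists>j. n \<le> hit j" using unb by blast
  define j where "j = (LEAST j. n \<le> hit j)"
  have le: "n \<le> hit j"
    unfolding j_def using \<open>\<exists>j. n \<le> hit j\<close> by (rule LeastI_ex)
  show ?thesis
  proof (cases j)
    case 0
    then have "n = hit 0" using le by simp
    then show ?thesis ..
  next
    case (Suc i)
    have "\<not> n \<le> hit i"
      using not_less_Least[of i "\<lambda>j. n \<le> hit j"] Suc by (simp add: j_def)
    then obtain k where k: "n = Suc (hit i + k)"
      by (metis add_Suc not_le less_iff_Suc_add)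
    have kl: "k < length (sig (letter i))"
      using le by (simp add: Suc hit_Suc k)
    have "sig (letter i) ! k > 0"
      using letters_sig[OF kl] pos by (simp add: k)
    then have "k = (a + letter i - 1) div b"
      using kl by (auto simp: sig_def nth_append split: if_splits)
    then have "n = hit (Suc i)"
      by (simp add: k hit_Suc length_sig)
    then show ?thesis ..
  qed
qed

section \<open>Separation and covering properties of the two sequences\<close>

lemma strict_mono_xs: "strict_mono xs"
  using b_pos by (simp add: strict_mono_Suc_iff xs_Suc)

lemma xs_gap: "i < n \<Longrightarrow> xs i + b \<le> xs n"
  using strict_mono_less_eq[OF strict_mono_xs, of "Suc i" n] by (simp add: xs_Suc Suc_le_eq)

lemma xs_ge: "n \<le> xs n"
  using strict_mono_xs by (rule strict_mono_imp_increasing)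

lemma ys_gap: "i < n \<Longrightarrow> ys i + b + a \<le> ys n"
proof -
  assume i: "i < n"
  then have "a * Suc i \<le> a * n" by (intro mult_le_mono) auto
  then show ?thesis using xs_gap[OF i] by (simp add: ys_def)
qed

lemma xs_le_ys: "xs n \<le> ys n"
  by (simp add: ys_def)

text \<open>The first element of \<open>xs\<close> after \<open>ys j\<close> is
  \<open>ys j + b\<close>, with index \<open>Suc (hit j)\<close>, so it suffices that
  \<open>n\<close> exceeds \<open>hit j\<close>. For \<open>j = 0\<close> this is exactly
  \<open>n > 0\<close>.\<close>

lemma xs_ys_sep: "ys j \<le> xs n \<Longrightarrow> n > 0 \<Longrightarrow> ys j + b \<le> xs n"
proof -
  assume le: "ys j \<le> xs n" and n: "n > 0"
  have "hit j < n"
  proof (cases "j = 0")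
    case False
    then have "xs (hit j) < ys j"
      using letter_hit_pos[of j] xs_hit[of j] by (simp add: xs_Suc)
    then show ?thesis
      using le strict_mono_less[OF strict_mono_xs, of "hit j" n] by simp
  qed (use n in simp)
  then show ?thesis
    using strict_mono_less_eq[OF strict_mono_xs, of "Suc (hit j)" n] xs_hit[of j] by simp
qed

text \<open>A point at distance at least \<open>b\<close> above \<open>xs i\<close> needs a gap with
  \<open>letter i > 0\<close>. Then \<open>i = hit j\<close>, so that
  \<open>ys j = xs i + letter i\<close> and the gap ends at \<open>ys j + b\<close>;
  \<open>letter i \<le> b\<close> gives the lower bound.\<close>

lemma cover:
  assumes "xs i \<le> v" "v < xs (Suc i)" "\<not> v < xs i + b"
  shows "\<exists>j. ys j \<le> v \<and> v < ys j + b"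
proof -
  have "letter i > 0" using assms by (simp add: xs_Suc)
  then obtain j where j: "i = hit j" using hit_if_letter_pos by blast
  have "ys j \<le> v"
    using assms xs_hit[of j] letter_le[of i] by (simp add: j xs_Suc)
  moreover have "v < ys j + b"
    using assms xs_hit[of j] by (simp add: j)
  ultimately show ?thesis by blast
qed

section \<open>Block decomposition\<close>

text \<open>The \<open>m\<close>-th block of \<open>block k\<close> (from \<open>m = 1\<close>) is \<open>block (k - 1 - shift m)\<close>.\<close>

definition shift :: "nat \<Rightarrow> nat" where
  "shift m = m * b div a"

text \<open>The number of zeros split off by the final letter in the course of \<open>k\<close>
  substitutions. Each of them grows into a block of its own.\<close>

definition nblocks :: "nat \<Rightarrow> nat" where
  "nblocks k = (k * a - 1) div b"

text \<open>The suffix of \<open>block k\<close> that starts with its \<open>m\<close>-th piece and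
  ends with the single final letter. The descent keeps it as the part still to be searched.\<close>

definition rest :: "nat \<Rightarrow> nat \<Rightarrow> nat list" where
  "rest k m = concat (map (\<lambda>j. block (k - 1 - shift j)) [m..<Suc (nblocks k)]) @
     [if k = 0 then 0 else Suc ((k * a - 1) mod b)]"

lemma shift_less_iff: "m > 0 \<Longrightarrow> shift m < k \<longleftrightarrow> m \<le> nblocks k"
proof -
  assume m: "m > 0"
  have "shift m < k \<longleftrightarrow> m * b < k * a"
    using a_pos by (simp add: shift_def div_less_iff_less_mult)
  also have "\<dots> \<longleftrightarrow> m * b \<le> k * a - 1"
    using m b_pos by (cases "k * a") auto
  also have "\<dots> \<longleftrightarrow> m \<le> nblocks k"
    using b_pos by (simp add: nblocks_def less_eq_div_iff_mult_less_eq)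
  finally show ?thesis .
qed

lemma nblocks_mono: "k \<le> l \<Longrightarrow> nblocks k \<le> nblocks l"
  unfolding nblocks_def by (intro div_le_mono diff_le_mono mult_le_mono) auto

lemma nblocks_le: "nblocks k \<le> k * a"
  unfolding nblocks_def using div_le_dividend[of "k * a - 1" b] by linarith

lemma rest_step: "m > 0 \<Longrightarrow> shift m < k \<Longrightarrow> rest k m = block (k - 1 - shift m) @ rest k (Suc m)"
  by (simp add: shift_less_iff rest_def upt_conv_Cons del: upt_Suc)

lemma length_rest_end: "m > 0 \<Longrightarrow> \<not> shift m < k \<Longrightarrow> length (rest k m) = 1"
  by (simp add: shift_less_iff rest_def)

lemma shift_new: "nblocks k < m \<Longrightarrow> m \<le> nblocks (Suc k) \<Longrightarrow> shift m = k"
  using shift_less_iff[of m k] shift_less_iff[of m "Suc k"] by auto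

text \<open>Substitution raises every piece by one level, while the final letter becomes some zeros,
  which are new copies of \<open>block 0\<close>, and a new final letter. The final letter stores a
  remainder modulo \<open>b\<close>, so the successive divisions combine into the single one of
  \<open>nblocks\<close>.\<close>

lemma block_rest: "block k = rest k 1"
proof (induction k)
  case 0
  show ?case by (simp add: rest_def nblocks_def)
next
  case (Suc k)
  \<comment> \<open>The case \<open>k = 0\<close> is separate because truncated subtraction would
    yield the final letter \<open>1\<close> instead of \<open>0\<close>.\<close>
  define t where "t = (if k = 0 then 0 else Suc ((k * a - 1) mod b))"
  have "a + t - 1 + nblocks k * b = Suc k * a - 1"
  proof (cases "k = 0")
    case False
    then have "k * a > 0" using a_pos by simp
    moreover have "(k * a - 1) mod b + (k * a - 1) div b * b = k * a - 1" by simp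
    ultimately show ?thesis using False by (simp add: t_def nblocks_def)
  qed (simp add: t_def nblocks_def)
  then have div: "nblocks (Suc k) = nblocks k + (a + t - 1) div b"
    and mod: "(Suc k * a - 1) mod b = (a + t - 1) mod b"
    using b_pos unfolding nblocks_def
    by (metis div_mult_self3 add.commute not_gr_zero, metis mod_mult_self1)
  let ?f = "\<lambda>j. block (k - shift j)"
  have 1: "concat (map ?f [Suc (nblocks k)..<Suc (nblocks (Suc k))]) =
      replicate (nblocks (Suc k) - nblocks k) 0"
  proof -
    have "map ?f [Suc (nblocks k)..<Suc (nblocks (Suc k))] =
        map (\<lambda>_. [0]) [Suc (nblocks k)..<Suc (nblocks (Suc k))]"
      by (intro map_cong) (auto simp: shift_new less_Suc_eq_le Suc_le_eq simp del: upt_Suc)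
    then show ?thesis by (simp add: map_replicate_const del: upt_Suc)
  qed
  have 2: "subst (concat (map (\<lambda>j. block (k - 1 - shift j)) [1..<Suc (nblocks k)])) =
      concat (map ?f [1..<Suc (nblocks k)])"
    unfolding subst_concat map_map
  proof (intro arg_cong[of _ _ concat] map_cong)
    fix j assume "j \<in> set [1..<Suc (nblocks k)]"
    then have "shift j < k"
      using shift_less_iff[of j k] by auto
    then show "(subst \<circ> (\<lambda>j. block (k - 1 - shift j))) j = ?f j"
      using block_Suc[of "k - 1 - shift j"] by (simp add: Suc_diff_Suc)
  qed simp
  have 3: "[1..<Suc (nblocks (Suc k))] =
      [1..<Suc (nblocks k)] @ [Suc (nblocks k)..<Suc (nblocks (Suc k))]"
    using nblocks_mono[of k "Suc k"] upt_add_eq_append[of 1 "Suc (nblocks k)" "nblocks (Suc k) - nblocks k"]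
    by simp
  have "block (Suc k) = subst (rest k 1)"
    by (simp add: block_Suc Suc)
  also have "\<dots> = concat (map ?f [1..<Suc (nblocks k)]) @ sig t"
    unfolding rest_def subst_simps(3) 2 by (simp add: t_def)
  also have "sig t = concat (map ?f [Suc (nblocks k)..<Suc (nblocks (Suc k))]) @
      [Suc ((Suc k * a - 1) mod b)]"
    unfolding 1 mod by (simp add: sig_def div)
  also have "concat (map ?f [1..<Suc (nblocks k)]) @ \<dots> = rest (Suc k) 1"
    unfolding rest_def 3 by (simp del: upt_Suc)
  finally show ?case .
qed

section \<open>Lengths of the blocks: recursion and exponential growth\<close>

lemma length_block_eq: "length (block k) = 1 + (\<Sum>j = 1..nblocks k. length (block (k - 1 - shift j)))"
proof -
  have "length (block k) = sum_list (map (\<lambda>j. length (block (k - 1 - shift j))) [1..<Suc (nblocks k)]) + 1"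
    unfolding block_rest[of k] rest_def by (simp add: length_concat comp_def del: upt_Suc)
  then show ?thesis
    by (simp add: sum_list_distinct_conv_sum_set atLeastLessThanSuc_atLeastAtMost del: upt_Suc)
qed

text \<open>Sum \<open>length_block_eq\<close> over the levels. Pieces that first appear at the next
  level have \<open>shift j = k\<close> and contribute \<open>plen 0 = 0\<close>, which allows the
  range to grow with \<open>k\<close>. The program fills its table by this recursion.\<close>

lemma plen_rec: "plen k = k + (\<Sum>j = 1..nblocks k. plen (k - 1 - shift j))"
proof (induction k)
  case 0
  show ?case by (simp add: nblocks_def)
next
  case (Suc k)
  have "plen (Suc k) = Suc k + (\<Sum>j = 1..nblocks k. plen (k - 1 - shift j) + length (block (k - 1 - shift j)))"
    by (subst plen_Suc, subst Suc, subst length_block_eq) (simp add: sum.distrib)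
  also have "(\<Sum>j = 1..nblocks k. plen (k - 1 - shift j) + length (block (k - 1 - shift j))) =
      (\<Sum>j = 1..nblocks k. plen (k - shift j))"
  proof (rule sum.cong)
    fix j assume "j \<in> {1..nblocks k}"
    then have "shift j < k" using shift_less_iff[of j k] by auto
    then show "plen (k - 1 - shift j) + length (block (k - 1 - shift j)) = plen (k - shift j)"
      using plen_Suc[of "k - 1 - shift j"] by (simp add: Suc_diff_Suc)
  qed simp
  also have "\<dots> = (\<Sum>j = 1..nblocks (Suc k). plen (k - shift j))"
    using nblocks_mono[of k "Suc k"] shift_new[of k]
    by (intro sum.mono_neutral_left) (auto simp: not_le)
  finally show ?case by simp
qed

text \<open>The recursion for \<open>k + b\<close> has \<open>a\<close> more pieces than that for
  \<open>k\<close>, and its piece \<open>j + a\<close> has the level of piece \<open>j\<close> for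
  \<open>k\<close>. Piece \<open>a\<close> yields the additional \<open>plen (k - 1)\<close>, and
  the leading summand yields \<open>b\<close>.\<close>

lemma plen_add: "plen (k + b) \<ge> plen k + plen (k - 1) + b"
proof (cases "k = 0")
  case True
  then show ?thesis using plen_ge[of b] by simp
next
  case False
  then have "k * a > 0" using a_pos by simp
  then have "(k + b) * a - 1 = k * a - 1 + a * b"
    by (simp add: algebra_simps)
  then have nb: "nblocks (k + b) = nblocks k + a"
    using b_pos by (simp add: nblocks_def)
  have sh: "shift (j + a) = shift j + b" for j
    using a_pos by (simp add: shift_def algebra_simps)
  have sa: "shift a = b" using a_pos by (simp add: shift_def)
  let ?g = "\<lambda>j. plen (k + b - 1 - shift j)"
  have "(\<Sum>j = 1..nblocks k. plen (k - 1 - shift j)) = (\<Sum>j = 1..nblocks k. ?g (j + a))"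
    by (simp add: sh)
  also have "\<dots> = (\<Sum>j = 1 + a..nblocks k + a. ?g j)"
    by (simp only: sum.shift_bounds_cl_nat_ivl)
  finally have "plen (k - 1) + (\<Sum>j = 1..nblocks k. plen (k - 1 - shift j)) =
      (\<Sum>j\<in>insert a {1 + a..nblocks k + a}. ?g j)"
    by (simp add: sa)
  also have "\<dots> \<le> (\<Sum>j = 1..nblocks (k + b). ?g j)"
    using a_pos by (intro sum_mono2) (auto simp: nb)
  finally show ?thesis
    using plen_rec[of k] plen_rec[of "k + b"] by linarith
qed

text \<open>Apply \<open>plen_add\<close> at \<open>Suc k\<close>. This doubling makes the number of
  levels logarithmic in the searched value.\<close>

lemma plen_double: "plen (k + (b + 1)) \<ge> 2 * plen k + 1"
  using plen_add[of "Suc k"] plen_mono[of k "Suc k"] b_pos by simp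

lemma plen_exp: "2 ^ q \<le> plen (q * (b + 1)) + 1"
proof (induction q)
  case (Suc q)
  then show ?case
    using plen_double[of "q * (b + 1)"] by (simp add: algebra_simps)
qed simp

section \<open>Factors of the fixed word at given indices\<close>

definition occurs :: "nat \<Rightarrow> nat list \<Rightarrow> bool" where
  "occurs n u \<longleftrightarrow> map letter [n..<n + length u] = u"

lemma occurs_append: "occurs n (u @ v) \<longleftrightarrow> occurs n u \<and> occurs (n + length u) v"
  unfolding occurs_def length_append add.assoc[symmetric] upt_add_eq_append[OF le_add1] map_append
  by (rule append_eq_append_conv) simp

lemma occurs_block: "occurs (plen k) (block k)"
proof -
  have "occurs 0 (pref (Suc k))"
    by (simp add: occurs_def pref_eq flip: plen_def)
  then show ?thesis
    by (simp add: pref_Suc occurs_append plen_def)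
qed

lemma xs_add: "xs (n + l) = xs n + weight (map letter [n..<n + l])"
  by (induction l) (auto simp: xs_Suc)

text \<open>Lets a search carry \<open>xs\<close> across a whole block from the weight alone,
  without looking at its letters.\<close>

lemma xs_occurs: "occurs n u \<Longrightarrow> xs (n + length u) = xs n + weight u"
  by (simp add: occurs_def xs_add)

section \<open>Remoteness\<close>

text \<open>Describes moves by their target, with integer differences on the diagonal so that linear
  arithmetic applies.\<close>

lemma mem_wyt_moves:
  "(u, v) \<in> wyt_moves a b (x, y) \<longleftrightarrow>
     u \<le> x \<and> v \<le> y \<and> (u, v) \<noteq> (x, y) \<and>
     (\<bar>(int x - int u) - (int y - int v)\<bar> < int a \<or> x - u < b \<or> y - v < b)"
proof
  assume "(u, v) \<in> wyt_moves a b (x, y)"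
  then obtain e d where "u = x - e" "v = y - d" "e \<le> x" "d \<le> y" "e + d > 0"
    "\<bar>int e - int d\<bar> < int a \<or> min e d < b"
    by (auto simp: wyt_moves_def)
  then show "u \<le> x \<and> v \<le> y \<and> (u, v) \<noteq> (x, y) \<and>
     (\<bar>(int x - int u) - (int y - int v)\<bar> < int a \<or> x - u < b \<or> y - v < b)"
    by (auto simp: of_nat_diff)
next
  assume *: "u \<le> x \<and> v \<le> y \<and> (u, v) \<noteq> (x, y) \<and>
     (\<bar>(int x - int u) - (int y - int v)\<bar> < int a \<or> x - u < b \<or> y - v < b)"
  then have "(u, v) = (x - (x - u), y - (y - v))"
    "x - u \<le> x" "y - v \<le> y" "x - u + (y - v) > 0"
    "\<bar>int (x - u) - int (y - v)\<bar> < int a \<or> min (x - u) (y - v) < b"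
    by (auto simp: of_nat_diff)
  then show "(u, v) \<in> wyt_moves a b (x, y)"
    unfolding wyt_moves_def fst_conv snd_conv by blast
qed

lemma swap_wyt_moves: "wyt_moves a b (prod.swap p) = prod.swap ` wyt_moves a b p"
proof -
  have *: "q \<in> wyt_moves a b (prod.swap p) \<longleftrightarrow> prod.swap q \<in> wyt_moves a b p" for q p
    by (cases p; cases q) (auto simp: mem_wyt_moves)
  show ?thesis
  proof (intro set_eqI)
    fix q show "q \<in> wyt_moves a b (prod.swap p) \<longleftrightarrow> q \<in> prod.swap ` wyt_moves a b p"
      unfolding * by (metis (no_types, lifting) image_iff swap_swap)
  qed
qed

lemma remoteness_swap: "remoteness a b (prod.swap p) = remoteness a b p"
proof (induction "fst p + snd p" arbitrary: p rule: less_induct)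
  case less
  have "remoteness a b ` wyt_moves a b (prod.swap p) = remoteness a b ` wyt_moves a b p"
    unfolding swap_wyt_moves image_image
    using less wyt_moves_decreasing by (intro image_cong) auto
  then show ?case
    by (simp add: remoteness.simps[of a b "prod.swap p"] remoteness.simps[of a b p])
qed

section \<open>The positions of even remoteness\<close>

definition ppos :: "nat \<Rightarrow> (nat \<times> nat) set" where
  "ppos n = {(xs n, ys n), (ys n, xs n)}"

definition reaches :: "nat \<times> nat \<Rightarrow> nat \<Rightarrow> bool" where
  "reaches p m \<longleftrightarrow> (\<exists>q\<in>ppos m. q \<in> wyt_moves a b p)"

text \<open>Moves lower the coordinate sum, so this order on the sums shows that moves between the
  sets \<open>ppos n\<close> can only lower the index.\<close>

lemma xs_ys_less_iff: "xs m + ys m < xs n + ys n \<longleftrightarrow> m < n"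
proof -
  have "strict_mono (\<lambda>n. xs n + ys n)"
    using b_pos by (simp add: strict_mono_Suc_iff xs_Suc ys_def)
  then show ?thesis using strict_mono_less[of "\<lambda>n. xs n + ys n" m n] by simp
qed

text \<open>The positions \<open>(xs n, ys n)\<close> lie on diagonals whose offsets are multiples
  of \<open>a\<close>, and a diagonal move changes the offset by less than \<open>a\<close>. The
  mirrored targets are the business of \<open>sum_diag\<close>.\<close>

lemma diff_diag: "\<bar>int (a * n) - int (a * m)\<bar> < int a \<longleftrightarrow> m = n"
proof
  assume *: "\<bar>int (a * n) - int (a * m)\<bar> < int a"
  have "int a * \<bar>int n - int m\<bar> < int a * 1"
    using * by (simp add: abs_mult flip: right_diff_distrib)
  then have "\<bar>int n - int m\<bar> < 1"
    using a_pos by (simp only: mult_less_cancel_left_pos of_nat_0_less_iff)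
  then show "m = n" by simp
qed (use a_pos in simp)

lemma sum_diag: "\<bar>int (a * n) + int (a * m)\<bar> < int a \<longleftrightarrow> m = 0 \<and> n = 0"
proof
  assume *: "\<bar>int (a * n) + int (a * m)\<bar> < int a"
  have "int a * int (n + m) < int a * 1"
    using * by (simp add: algebra_simps flip: of_nat_mult of_nat_add)
  then have "int (n + m) < 1"
    using a_pos by (simp only: mult_less_cancel_left_pos of_nat_0_less_iff)
  then show "m = 0 \<and> n = 0" by simp
qed (use a_pos in simp)

lemma ppos_sum: "p \<in> ppos n \<Longrightarrow> fst p + snd p = xs n + ys n"
  by (auto simp: ppos_def)

lemma ys_diff: "int (ys n) = int (xs n) + int (a * n)"
  by (simp add: ys_def)

lemma reaches_less:
  assumes "reaches p m" "p \<in> ppos n"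
  shows "m < n"
proof -
  obtain q where q: "q \<in> ppos m" "q \<in> wyt_moves a b p"
    using assms by (auto simp: reaches_def)
  then have "fst q + snd q < fst p + snd p"
    using wyt_moves_decreasing by blast
  then show ?thesis
    using ppos_sum q(1) assms(2) xs_ys_less_iff by metis
qed

text \<open>A move with a side shorter than \<open>b\<close> contradicts the gaps of
  \<open>xs\<close> and \<open>ys\<close> or, for a mirrored target, \<open>xs_ys_sep\<close>. A
  diagonal move contradicts \<open>diff_diag\<close> or \<open>sum_diag\<close>.\<close>

lemma ppos_not_reaches:
  assumes "p \<in> ppos n"
  shows "\<not> reaches p m"
proof
  assume r: "reaches p m"
  have mn: "m < n" using reaches_less[OF r assms] .
  have gaps: "xs m + b \<le> xs n" "ys m + b \<le> ys n" "xs m + b \<le> ys n"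
    using xs_gap[OF mn] ys_gap[OF mn] xs_le_ys[of n] by linarith+
  have sep: "ys m \<le> xs n \<Longrightarrow> ys m + b \<le> xs n"
    using xs_ys_sep[of m n] mn by simp
  have dd: "\<not> \<bar>int (a * n) - int (a * m)\<bar> < int a" "\<not> \<bar>int (a * n) + int (a * m)\<bar> < int a"
    using diff_diag[of n m] sum_diag[of n m] mn by auto
  show False
    using r assms gaps sep dd a_pos ys_diff[of n] ys_diff[of m]
    unfolding reaches_def ppos_def by (auto simp: mem_wyt_moves)
qed

text \<open>The position arises from \<open>(xs (Suc n), ys (Suc n))\<close> by lowering the second
  coordinate by \<open>a\<close>, which puts it on the diagonal of \<open>ppos n\<close>. As it
  reaches no other \<open>ppos m\<close>, it is the option that attains the maximum in the
  remoteness of \<open>ppos (Suc n)\<close>.\<close>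

lemma ppos_predecessor:
  assumes "reaches (xs (Suc n), xs (Suc n) + a * n) m"
  shows "m = n"
proof -
  let ?x = "xs (Suc n)" and ?y = "xs (Suc n) + a * n"
  have lt: "m < Suc n"
  proof -
    obtain q where q: "q \<in> ppos m" "q \<in> wyt_moves a b (?x, ?y)"
      using assms by (auto simp: reaches_def)
    have "xs m + ys m < ?x + ?y"
      using wyt_moves_decreasing[OF q(2)] ppos_sum[OF q(1)] by simp
    also have "\<dots> < ?x + ys (Suc n)"
      using a_pos by (simp add: ys_def)
    finally show ?thesis by (simp add: xs_ys_less_iff)
  qed
  have amn: "a * m \<le> a * n" using lt by simp
  have gaps: "xs m + b \<le> ?x" "ys m + b \<le> ?y"
    unfolding ys_def using xs_gap[OF lt] amn by linarith+
  have sep: "ys m \<le> ?x \<Longrightarrow> ys m + b \<le> ?x"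
    using xs_ys_sep[of m "Suc n"] by simp
  have "\<bar>int (a * n) - int (a * m)\<bar> < int a \<or> \<bar>int (a * n) + int (a * m)\<bar> < int a"
    using assms gaps sep ys_diff[of m]
    unfolding reaches_def ppos_def by (auto simp: mem_wyt_moves)
  then show ?thesis using diff_diag[of n m] sum_diag[of n m] by auto
qed

section \<open>The least index that a position can reach\<close>

definition max_below :: "(nat \<Rightarrow> nat) \<Rightarrow> nat \<Rightarrow> nat \<Rightarrow> bool" where
  "max_below f v i \<longleftrightarrow> f i \<le> v \<and> v < f (Suc i)"

lemma max_below_xs_le: "max_below xs v i \<Longrightarrow> xs m \<le> v \<Longrightarrow> m \<le> i"
  using strict_mono_less_eq[OF strict_mono_xs, of "Suc i" m]
  by (auto simp: max_below_def not_less_eq_eq[symmetric])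

lemma strict_mono_ys: "strict_mono ys"
  using b_pos by (simp add: strict_mono_Suc_iff xs_Suc ys_def)

lemma max_below_ys_le: "max_below ys v i \<Longrightarrow> ys m \<le> v \<Longrightarrow> m \<le> i"
  using strict_mono_less_eq[OF strict_mono_ys, of "Suc i" m]
  by (auto simp: max_below_def not_less_eq_eq[symmetric])

lemma ex_max_below:
  assumes "strict_mono f" "f 0 = 0"
  shows "\<exists>i. max_below f v i"
proof -
  have ex: "\<exists>i. v < f (Suc i)"
    using strict_mono_imp_increasing[OF assms(1), of "Suc v"] by (intro exI[of _ v]) simp
  define i where "i = (LEAST i. v < f (Suc i))"
  have "v < f (Suc i)" unfolding i_def using ex by (rule LeastI_ex)
  moreover have "f i \<le> v"
  proof (cases i)
    case (Suc k)
    then show ?thesis using not_less_Least[of k "\<lambda>i. v < f (Suc i)"] by (simp add: i_def)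
  qed (simp add: assms)
  ultimately show ?thesis unfolding max_below_def by blast
qed

text \<open>For \<open>x \<le> y\<close> outside all \<open>ppos n\<close>, this is the least
  \<open>m\<close> such that \<open>ppos m\<close> can be reached. The first argument of
  \<open>min\<close> comes from diagonal moves, the second from moves with a short side in
  \<open>x\<close>: to the mirror image with \<open>ys j\<close> if it is near enough, otherwise to
  \<open>xs i\<close>.\<close>

definition entry :: "nat \<Rightarrow> nat \<Rightarrow> nat \<Rightarrow> nat \<Rightarrow> nat" where
  "entry x y i j = min ((y - x) div a) (if x < ys j + b then j else i)"

lemma ppos_iff:
  assumes "x \<le> y" "max_below xs x i"
  shows "(x, y) \<in> ppos n \<longleftrightarrow> n = i \<and> x = xs i \<and> y = ys i"
proof
  assume "(x, y) \<in> ppos n"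
  then have *: "x = xs n \<and> y = ys n"
    using assms(1) by (auto simp: ppos_def ys_def)
  then have "n \<le> i" using max_below_xs_le[OF assms(2)] by simp
  moreover have "i \<le> n"
    using assms(2) * strict_mono_less_eq[OF strict_mono_xs, of i n] by (simp add: max_below_def)
  ultimately show "n = i \<and> x = xs i \<and> y = ys i" using * by simp
qed (simp add: ppos_def)

context
  fixes x y i j
  assumes xy: "x \<le> y" and i: "max_below xs x i" and j: "max_below ys x j"
    and nonP: "\<And>n. (x, y) \<notin> ppos n"
begin

lemma j_le_i: "j \<le> i"
  using max_below_xs_le[OF i, of j] j xs_le_ys[of j] by (simp add: max_below_def)

lemma reaches_I:
  assumes "xs m \<le> x" "ys m \<le> y" "\<bar>int (y - x) - int (a * m)\<bar> < int a \<or> x < xs m + b"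
  shows "reaches (x, y) m"
proof -
  have "(xs m, ys m) \<noteq> (x, y)" using nonP[of m] by (auto simp: ppos_def)
  then have "(xs m, ys m) \<in> wyt_moves a b (x, y)"
    using assms ys_diff[of m] xy by (auto simp: mem_wyt_moves of_nat_diff)
  then show ?thesis by (auto simp: reaches_def ppos_def)
qed

lemma diag_le: "m \<le> (y - x) div a \<Longrightarrow> xs m \<le> x \<Longrightarrow> ys m \<le> y"
proof -
  assume "m \<le> (y - x) div a" and x: "xs m \<le> x"
  then have "a * m \<le> y - x"
    using a_pos by (simp add: less_eq_div_iff_mult_less_eq mult.commute)
  then show ?thesis using x xy by (simp add: ys_def)
qed

lemma reaches_entry: "reaches (x, y) (entry x y i j)"
proof -
  let ?d = "(y - x) div a"
  have diag: "\<bar>int (y - x) - int (a * ?d)\<bar> < int a"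
  proof -
    have "int (y - x) - int (a * ?d) = int ((y - x) mod a)"
      by (metis minus_mult_div_eq_mod mult.commute of_nat_diff times_div_less_eq_dividend)
    then show ?thesis using a_pos by simp
  qed
  consider "entry x y i j = ?d" "?d \<le> i" | "entry x y i j = j" "x < ys j + b"
    | "entry x y i j = i" "i \<le> ?d" "\<not> x < ys j + b"
  proof -
    have "entry x y i j = min ?d j \<and> x < ys j + b \<or>
        entry x y i j = min ?d i \<and> \<not> x < ys j + b"
      by (simp add: entry_def)
    then have "entry x y i j = ?d \<and> ?d \<le> i \<or> entry x y i j = j \<and> x < ys j + b \<or>
        entry x y i j = i \<and> i \<le> ?d \<and> \<not> x < ys j + b"
      using j_le_i by linarith
    then show ?thesis using that by blast
  qed
  then show ?thesis
  proof cases
    case 1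
    then have "xs ?d \<le> x"
      using i strict_mono_less_eq[OF strict_mono_xs, of ?d i] by (simp add: max_below_def)
    then show ?thesis
      unfolding 1 using diag_le diag by (intro reaches_I) auto
  next
    case 2
    have "ys j \<le> x" using j by (simp add: max_below_def)
    moreover have "(ys j, xs j) \<noteq> (x, y)" using nonP[of j] by (auto simp: ppos_def)
    ultimately have "(ys j, xs j) \<in> wyt_moves a b (x, y)"
      using 2 xy xs_le_ys[of j] b_pos by (auto simp: mem_wyt_moves)
    then show ?thesis unfolding 2 by (auto simp: reaches_def ppos_def)
  next
    case 3
    \<comment> \<open>Otherwise \<open>cover\<close> would put \<open>x\<close> less than
      \<open>b\<close> above some \<open>ys l\<close>, and \<open>l \<le> j\<close> would give
      \<open>x < ys j + b\<close>.\<close>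
    have "x < xs i + b"
    proof (rule ccontr)
      assume "\<not> x < xs i + b"
      then obtain l where l: "ys l \<le> x" "x < ys l + b"
        using cover[of i x] i by (auto simp: max_below_def)
      then have "l \<le> j" using max_below_ys_le[OF j] by simp
      then have "ys l \<le> ys j" using strict_mono_less_eq[OF strict_mono_ys] by simp
      then show False using l 3 by simp
    qed
    moreover have "xs i \<le> x" using i by (simp add: max_below_def)
    ultimately show ?thesis
      unfolding 3 using 3 diag_le by (intro reaches_I) auto
  qed
qed

text \<open>Suppose the target is \<open>(xs m, ys m)\<close> with \<open>m\<close> below the
  diagonal index. Then the move is not diagonal and its shorter side is in \<open>x\<close>, so
  \<open>m = i\<close>. For the mirrored target, a side below \<open>b\<close> in \<open>x\<close>
  gives \<open>m = j\<close>; otherwise the move is diagonal, so \<open>y - x < a\<close> and the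
  entry is \<open>0\<close>.\<close>

lemma entry_le: "reaches (x, y) m \<Longrightarrow> entry x y i j \<le> m"
proof -
  let ?d = "(y - x) div a"
  assume "reaches (x, y) m"
  then consider "(xs m, ys m) \<in> wyt_moves a b (x, y)" | "(ys m, xs m) \<in> wyt_moves a b (x, y)"
    by (auto simp: reaches_def ppos_def)
  then show ?thesis
  proof cases
    case 1
    then have le: "xs m \<le> x" "ys m \<le> y" by (auto simp: mem_wyt_moves)
    have mi: "m \<le> i" using max_below_xs_le[OF i le(1)] .
    show ?thesis
    proof (cases "?d \<le> m")
      case False
      then have "Suc m * a \<le> y - x"
        using a_pos by (simp add: not_le Suc_le_eq[symmetric] less_eq_div_iff_mult_less_eq del: mult_Suc)
      then have "int (Suc m * a) \<le> int (y - x)"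
        by (simp only: of_nat_le_iff)
      then have "int a + int (a * m) \<le> int y - int x"
        using xy by (simp add: algebra_simps of_nat_diff)
      then have "x - xs m < b"
        using 1 ys_diff[of m] xy by (auto simp: mem_wyt_moves)
      then have "\<not> m < i"
        using xs_gap[of m i] i le by (auto simp: max_below_def)
      then show ?thesis using mi j_le_i by (auto simp: entry_def)
    qed (simp add: entry_def)
  next
    case 2
    then have le: "ys m \<le> x" "xs m \<le> y" by (auto simp: mem_wyt_moves)
    have mj: "m \<le> j" using max_below_ys_le[OF j le(1)] .
    show ?thesis
    proof (cases "x - ys m < b")
      case True
      then have "\<not> m < j"
        using ys_gap[of m j] j le by (auto simp: max_below_def)
      then have "m = j" using mj by simp
      then show ?thesis using True le by (auto simp: entry_def)
    next
      case False
      then have "\<bar>(int x - int (ys m)) - (int y - int (xs m))\<bar> < int a"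
        using 2 xy xs_le_ys[of m] by (auto simp: mem_wyt_moves)
      then have "y - x < a"
        using ys_diff[of m] xy of_nat_0_le_iff[of "a * m"] by linarith
      then show ?thesis by (simp add: entry_def)
    qed
  qed
qed

end

lemma ex_entry:
  assumes "\<And>n. p \<notin> ppos n"
  shows "\<exists>m. reaches p m"
proof -
  have *: "\<exists>m. reaches (x, y) m" if "x \<le> y" "\<And>n. (x, y) \<notin> ppos n" for x y
    using reaches_entry[OF that(1) _ _ that(2)] ex_max_below[OF strict_mono_xs]
      ex_max_below[OF strict_mono_ys] by (metis xs_0 ys_0)
  have swap: "prod.swap q \<in> ppos n \<longleftrightarrow> q \<in> ppos n" for q n
    by (cases q) (auto simp: ppos_def)
  have swap': "reaches p m" if "reaches (prod.swap p) m" for m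
    using that swap unfolding reaches_def swap_wyt_moves by auto
  obtain x y where p: "p = (x, y)" by (cases p)
  show ?thesis
  proof (cases "x \<le> y")
    case True
    then show ?thesis using * assms p by blast
  next
    case False
    then have "\<exists>m. reaches (y, x) m"
      using * assms swap[of p] p by simp
    then show ?thesis using swap' p by auto
  qed
qed

text \<open>Both parts need each other at smaller sums, hence one joint induction. Options of a
  position in \<open>ppos n\<close> are odd, so the maximum decides; elsewhere the even options are
  those in some \<open>ppos m\<close>, so the minimum decides.\<close>

theorem remoteness_ppos:
  "(p \<in> ppos n \<longrightarrow> remoteness a b p = 2 * n) \<and>
   ((\<forall>n. p \<notin> ppos n) \<longrightarrow> remoteness a b p = 1 + 2 * (LEAST m. reaches p m))"
proof (induction "fst p + snd p" arbitrary: p n rule: less_induct)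
  case less
  let ?V = "remoteness a b ` wyt_moves a b p"
  note IH = less[OF wyt_moves_decreasing]
  have finV: "finite ?V" using finite_wyt_moves by blast
  have rem: "remoteness a b p = remoteness_step ?V" by (rule remoteness.simps)
  show ?case
  proof (intro conjI impI)
    assume p: "p \<in> ppos n"
    have opt: "remoteness a b q = 1 + 2 * (LEAST m. reaches q m) \<and> reaches q (LEAST m. reaches q m) \<and>
        (LEAST m. reaches q m) < n" if q: "q \<in> wyt_moves a b p" for q
    proof (intro conjI)
      have nonP: "q \<notin> ppos m" for m
        using ppos_not_reaches[OF p, of m] q by (auto simp: reaches_def)
      show "remoteness a b q = 1 + 2 * (LEAST m. reaches q m)"
        using IH[OF q] nonP by blast
      show r: "reaches q (LEAST m. reaches q m)"
        using ex_entry[OF nonP] by (rule LeastI_ex)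
      then obtain q' where "q' \<in> ppos (LEAST m. reaches q m)" "q' \<in> wyt_moves a b q"
        by (auto simp: reaches_def)
      then have "xs (LEAST m. reaches q m) + ys (LEAST m. reaches q m) < xs n + ys n"
        using wyt_moves_decreasing[of q' a b q] wyt_moves_decreasing[OF q] ppos_sum[OF p]
          ppos_sum[of q'] by simp
      then show "(LEAST m. reaches q m) < n" by (simp add: xs_ys_less_iff)
    qed
    show "remoteness a b p = 2 * n"
    proof (cases n)
      case 0
      then have "wyt_moves a b p = {}" using opt by auto
      then show ?thesis using 0 by (simp add: rem remoteness_step_def)
    next
      case (Suc k)
      \<comment> \<open>The option of largest remoteness is that of \<open>ppos_predecessor\<close>,
        or its mirror image if \<open>p\<close> is the mirrored position.\<close>
      obtain q where q: "q \<in> wyt_moves a b p" "\<And>m. reaches q m \<Longrightarrow> m = k"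
      proof -
        let ?q = "(xs (Suc k), xs (Suc k) + a * k)"
        have q: "?q \<in> wyt_moves a b (xs n, ys n)"
          using a_pos b_pos by (simp add: mem_wyt_moves Suc ys_def)
        have q': "prod.swap ?q \<in> wyt_moves a b (ys n, xs n)"
          using q swap_wyt_moves[of "(xs n, ys n)"] by (metis image_eqI swap_simp)
        have swap: "reaches ?q m" if "reaches (prod.swap ?q) m" for m
          using that unfolding reaches_def swap_wyt_moves by (auto simp: ppos_def)
        show ?thesis
          using p that q q' swap ppos_predecessor unfolding ppos_def by blast
      qed
      have "remoteness a b q = 2 * k + 1"
        using opt[OF q(1)] q(2) by simp
      then have mem: "2 * k + 1 \<in> ?V" using q(1) by (metis image_eqI)
      have le: "v \<le> 2 * k + 1" if "v \<in> ?V" for v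
        using that opt by (auto simp: Suc less_Suc_eq_le)
      have "Max ?V = 2 * k + 1"
        using finV le mem by (intro Max_eqI) auto
      moreover have "\<not> (\<exists>v\<in>?V. even v)"
        using opt by auto
      ultimately show ?thesis
        using mem by (auto simp: rem remoteness_step_def Suc)
    qed
  next
    assume nonP: "\<forall>n. p \<notin> ppos n"
    define l where "l = (LEAST m. reaches p m)"
    have l: "reaches p l"
      unfolding l_def using ex_entry[of p] nonP LeastI_ex[of "reaches p"] by auto
    have mem: "2 * l \<in> ?V"
    proof -
      obtain q where q: "q \<in> ppos l" "q \<in> wyt_moves a b p" using l by (auto simp: reaches_def)
      then have "remoteness a b q = 2 * l" using IH by blast
      then show ?thesis using q(2) by (metis image_eqI)
    qed
    have le: "2 * l \<le> v" if v: "v \<in> ?V" "even v" for v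
    proof -
      obtain q where q: "q \<in> wyt_moves a b p" "v = remoteness a b q" using v by blast
      obtain m where m: "q \<in> ppos m" using IH[OF q(1)] q(2) v(2) by fastforce
      then have "v = 2 * m" using IH[OF q(1)] q(2) by simp
      moreover have "reaches p m" using m q(1) by (auto simp: reaches_def)
      ultimately show ?thesis unfolding l_def by (simp add: Least_le)
    qed
    have "Min {v \<in> ?V. even v} = 2 * l"
      using finV le mem by (intro Min_eqI) auto
    moreover have "\<exists>v\<in>?V. even v" using mem by (meson dvd_triv_left)
    ultimately show "remoteness a b p = 1 + 2 * (LEAST m. reaches p m)"
      by (auto simp: rem remoteness_step_def l_def)
  qed
qed

theorem remoteness_formula:
  assumes "x \<le> y" "max_below xs x i" "max_below ys x j"
  shows "remoteness a b (x, y) = (if x = xs i \<and> y = ys i then 2 * i else 1 + 2 * entry x y i j)"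
proof (cases "x = xs i \<and> y = ys i")
  case True
  then have "(x, y) \<in> ppos i" by (simp add: ppos_def)
  then show ?thesis using True remoteness_ppos[of "(x, y)" i] by simp
next
  case False
  then have nonP: "(x, y) \<notin> ppos n" for n
    using ppos_iff[OF assms(1,2)] by blast
  have "(LEAST m. reaches (x, y) m) = entry x y i j"
    using reaches_entry[OF assms nonP] entry_le[OF assms nonP] by (rule Least_equality)
  then have "remoteness a b (x, y) = 1 + 2 * entry x y i j"
    using remoteness_ppos[of "(x, y)"] nonP by simp
  then show ?thesis unfolding if_not_P[OF False] .
qed

end

section \<open>Reasoning about running time\<close>

definition loc_le :: "nat \<Rightarrow> loc \<Rightarrow> bool" where
  "loc_le B l = (case l of Direct i \<Rightarrow> i \<le> B | Indirect i \<Rightarrow> i \<le> B)"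

definition operand_le :: "nat \<Rightarrow> operand \<Rightarrow> bool" where
  "operand_le B u = (case u of Const n \<Rightarrow> n \<le> B | Cell l \<Rightarrow> loc_le B l)"

lemma loc_le_simps [simp]:
  "loc_le B (Direct i) \<longleftrightarrow> i \<le> B" "loc_le B (Indirect i) \<longleftrightarrow> i \<le> B"
  by (simp_all add: loc_le_def)

lemma operand_le_simps [simp]:
  "operand_le B (Const n) \<longleftrightarrow> n \<le> B" "operand_le B (Cell l) \<longleftrightarrow> loc_le B l"
  by (simp_all add: operand_le_def)

lemma bit_len_mono: "i \<le> j \<Longrightarrow> bit_len i \<le> bit_len j"
  unfolding bit_len_def by (intro max.mono floorlog_mono) auto

lemma bit_len_pos: "1 \<le> bit_len n"
  by (simp add: bit_len_def)

definition bounded :: "nat \<Rightarrow> memory \<Rightarrow> bool" where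
  "bounded B m \<longleftrightarrow> (\<forall>i. m i \<le> B)"

lemma boundedD: "bounded B m \<Longrightarrow> m i \<le> B"
  by (simp add: bounded_def)

lemma bounded_upd: "bounded B m \<Longrightarrow> w \<le> B \<Longrightarrow> bounded B (m(i := w))"
  by (simp add: bounded_def)

lemma address_cost_le: "bounded B m \<Longrightarrow> loc_le B l \<Longrightarrow> address_cost m l \<le> 2 * bit_len B"
proof (cases l)
  case (Indirect i)
  assume "bounded B m" "loc_le B l"
  then have "bit_len i \<le> bit_len B" "bit_len (m i) \<le> bit_len B"
    using Indirect by (simp_all add: bit_len_mono boundedD)
  then show ?thesis using Indirect by simp
qed (auto dest: bit_len_mono)

lemma operand_cost_le: "bounded B m \<Longrightarrow> operand_le B u \<Longrightarrow> operand_cost m u \<le> 3 * bit_len B"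
proof (cases u)
  case (Cell l)
  assume *: "bounded B m" "operand_le B u"
  then have "address_cost m l \<le> 2 * bit_len B"
    using Cell by (intro address_cost_le) auto
  moreover have "bit_len (m (address m l)) \<le> bit_len B"
    using * by (simp add: bit_len_mono boundedD)
  ultimately show ?thesis using Cell by simp
qed (auto dest: bit_len_mono)

text \<open>
  Total correctness in at most \<open>s\<close> steps while all cells stay below \<open>B\<close>; under that bound
  every step costs at most \<open>8 * bit_len B\<close>.
\<close>

definition wp :: "nat \<Rightarrow> nat \<Rightarrow> prog \<Rightarrow> (memory \<Rightarrow> bool) \<Rightarrow> memory \<Rightarrow> bool" where
  "wp B s c Q m \<longleftrightarrow> (bounded B m \<longrightarrow>
     (\<exists>m' t. runs c m m' t \<and> t \<le> s * (8 * bit_len B) \<and> bounded B m' \<and> Q m'))"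

lemma wp_mono: "wp B s c Q m \<Longrightarrow> s \<le> s' \<Longrightarrow> (\<And>m'. Q m' \<Longrightarrow> Q' m') \<Longrightarrow> wp B s' c Q' m"
  unfolding wp_def by (meson le_trans mult_le_mono1)

lemma wp_Skip: "Q m \<Longrightarrow> wp B 1 Skip Q m"
  unfolding wp_def using runs.Skip[of m] bit_len_pos[of B]
  by (intro impI exI[of _ m] exI[of _ 1]) simp

lemma wp_Assign:
  assumes "loc_le B l" "operand_le B u" "operand_le B v"
    and "apply_op f (operand_val m u) (operand_val m v) \<le> B"
    and "Q (m(address m l := apply_op f (operand_val m u) (operand_val m v)))"
  shows "wp B 1 (Assign l f u v) Q m"
  unfolding wp_def
proof
  assume B: "bounded B m"
  \<comment> \<open>In units of \<open>bit_len B\<close>: two for the target address and three for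
    each operand.\<close>
  have "address_cost m l + operand_cost m u + operand_cost m v \<le> 1 * (8 * bit_len B)"
    using address_cost_le[OF B assms(1)] operand_cost_le[OF B assms(2)]
      operand_cost_le[OF B assms(3)] by simp
  then show "\<exists>m' t. runs (Assign l f u v) m m' t \<and> t \<le> 1 * (8 * bit_len B) \<and> bounded B m' \<and> Q m'"
    using runs.Assign assms(4,5) bounded_upd[OF B] by blast
qed

lemma wp_Seq: "wp B s1 c1 (wp B s2 c2 Q) m \<Longrightarrow> wp B (s1 + s2) (Seq c1 c2) Q m"
  unfolding wp_def
proof
  assume *: "bounded B m \<longrightarrow> (\<exists>m' t. runs c1 m m' t \<and> t \<le> s1 * (8 * bit_len B) \<and> bounded B m' \<and>
    (bounded B m' \<longrightarrow> (\<exists>m'' t. runs c2 m' m'' t \<and> t \<le> s2 * (8 * bit_len B) \<and> bounded B m'' \<and> Q m'')))"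
    and "bounded B m"
  then obtain m1 t1 m2 t2 where "runs c1 m m1 t1" "t1 \<le> s1 * (8 * bit_len B)"
    "runs c2 m1 m2 t2" "t2 \<le> s2 * (8 * bit_len B)" "bounded B m2" "Q m2"
    by blast
  moreover from this have "t1 + t2 \<le> (s1 + s2) * (8 * bit_len B)"
    by (simp add: add_mult_distrib)
  ultimately show "\<exists>m' t. runs (Seq c1 c2) m m' t \<and> t \<le> (s1 + s2) * (8 * bit_len B) \<and> bounded B m' \<and> Q m'"
    using runs.Seq by blast
qed

lemma wp_If:
  assumes "operand_le B u" "operand_val m u > 0 \<Longrightarrow> wp B s c1 Q m"
    "operand_val m u = 0 \<Longrightarrow> wp B s c2 Q m"
  shows "wp B (1 + s) (If u c1 c2) Q m"
  unfolding wp_def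
proof
  assume B: "bounded B m"
  have cost: "operand_cost m u \<le> 8 * bit_len B"
    using operand_cost_le[OF B assms(1)] by linarith
  obtain m' t where r: "runs (If u c1 c2) m m' (operand_cost m u + t)" "t \<le> s * (8 * bit_len B)"
    "bounded B m'" "Q m'"
  proof (cases "operand_val m u > 0")
    case True
    then show ?thesis using that assms(2) B runs.IfTrue unfolding wp_def by blast
  next
    case False
    then show ?thesis using that assms(3) B runs.IfFalse unfolding wp_def by blast
  qed
  show "\<exists>m' t. runs (If u c1 c2) m m' t \<and> t \<le> (1 + s) * (8 * bit_len B) \<and> bounded B m' \<and> Q m'"
    using r cost by (intro exI[of _ m'] exI[of _ "operand_cost m u + t"]) (simp add: add_mult_distrib)
qed

lemma wp_While:
  assumes u: "operand_le B u"
    and body: "\<And>m. I m \<Longrightarrow> operand_val m u > 0 \<Longrightarrow> wp B s c (\<lambda>m'. I m' \<and> V m' < V m) m"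
    and exit: "\<And>m. I m \<Longrightarrow> operand_val m u = 0 \<Longrightarrow> Q m"
    and init: "I m" "V m \<le> N"
  shows "wp B ((N + 1) * (s + 1)) (While u c) Q m"
proof -
  \<comment> \<open>One test and one body per iteration, plus the final test; the stated bound
    rounds this up.\<close>
  have "wp B (N * (s + 1) + 1) (While u c) Q m" using init
  proof (induction N arbitrary: m rule: less_induct)
    case (less N)
    show ?case unfolding wp_def
    proof
      assume B: "bounded B m"
      have cost: "operand_cost m u \<le> 8 * bit_len B"
        using operand_cost_le[OF B u] by linarith
      show "\<exists>m' t. runs (While u c) m m' t \<and> t \<le> (N * (s + 1) + 1) * (8 * bit_len B) \<and>
          bounded B m' \<and> Q m'"
      proof (cases "operand_val m u = 0")
        case True
        then have "runs (While u c) m m (operand_cost m u)" by (rule runs.WhileFalse)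
        moreover have "operand_cost m u \<le> (N * (s + 1) + 1) * (8 * bit_len B)"
          using cost by (simp add: trans_le_add1 add_mult_distrib)
        ultimately show ?thesis using B exit less.prems(1) True by blast
      next
        case False
        then obtain m1 t1 where 1: "runs c m m1 t1" "t1 \<le> s * (8 * bit_len B)" "bounded B m1"
          "I m1" "V m1 < V m"
          using body[of m] less.prems(1) B unfolding wp_def by blast
        then obtain N' where N: "N = Suc N'" "V m1 \<le> N'"
          using less.prems(2) by (cases N) auto
        then obtain m2 t2 where 2: "runs (While u c) m1 m2 t2"
          "t2 \<le> (N' * (s + 1) + 1) * (8 * bit_len B)" "bounded B m2" "Q m2"
          using less.IH[of N' m1] 1 unfolding wp_def by auto
        have "runs (While u c) m m2 (operand_cost m u + t1 + t2)"
          using False 1 2 by (intro runs.WhileTrue) auto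
        moreover have "operand_cost m u + t1 + t2 \<le> (N * (s + 1) + 1) * (8 * bit_len B)"
        proof -
          have "operand_cost m u + t1 + t2 \<le>
              8 * bit_len B + s * (8 * bit_len B) + (N' * (s + 1) + 1) * (8 * bit_len B)"
            using cost 1(2) 2(2) by linarith
          also have "\<dots> = (N * (s + 1) + 1) * (8 * bit_len B)"
            by (simp add: N algebra_simps)
          finally show ?thesis .
        qed
        ultimately show ?thesis using 2 by blast
      qed
    qed
  qed
  then show ?thesis by (rule wp_mono) simp_all
qed

section \<open>Straight-line code\<close>

type_synonym instr = "loc \<times> arith_op \<times> operand \<times> operand"

fun line :: "instr list \<Rightarrow> prog" where
  "line [] = Skip"
| "line ((l, f, u, v) # is) = Seq (Assign l f u v) (line is)"

text \<open>A symbolic evaluator: simplification computes the final memory and collects the side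
  conditions that keep everything below \<open>B\<close>.\<close>

fun exec :: "nat \<Rightarrow> instr list \<Rightarrow> (memory \<Rightarrow> bool) \<Rightarrow> memory \<Rightarrow> bool" where
  "exec B [] Q m = Q m"
| "exec B ((l, f, u, v) # is) Q m =
     (loc_le B l \<and> operand_le B u \<and> operand_le B v \<and>
      apply_op f (operand_val m u) (operand_val m v) \<le> B \<and>
      exec B is Q (m(address m l := apply_op f (operand_val m u) (operand_val m v))))"

lemma exec_append: "exec B (is @ js) Q m = exec B is (exec B js Q) m"
  by (induction "is" arbitrary: m) auto

text \<open>The closing \<open>Skip\<close> of \<open>line\<close> takes one more step, hence the
  strict inequality.\<close>

lemma wp_line: "exec B is Q m \<Longrightarrow> length is < s \<Longrightarrow> wp B s (line is) Q m"
proof (induction "is" arbitrary: m s)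
  case Nil
  then show ?case by (auto intro: wp_mono[OF wp_Skip])
next
  case (Cons i "is")
  obtain l f u v where i: "i = (l, f, u, v)" by (cases i)
  obtain s' where s: "s = 1 + s'" "length is < s'" using Cons.prems(2) by (cases s) auto
  show ?case
    using Cons s(2) unfolding i s(1) line.simps exec.simps by (intro wp_Seq wp_Assign) auto
qed

abbreviation cell :: "nat \<Rightarrow> operand" where
  "cell i \<equiv> Cell (Direct i)"

section \<open>The program\<close>

text \<open>
  Cells: 4 \<open>lo = min x y\<close>; 5 \<open>dd = |x - y|\<close>; 6 \<open>lo + 1\<close>; 7 current level; 13 the weight \<open>\<alpha>\<close> of a search
  for the largest \<open>n\<close> with \<open>\<alpha> n + x\<^sub>n \<le> lo\<close>; 14 and 15 the current \<open>n\<close> and \<open>x\<^sub>n\<close>; 16 \<open>m b\<close> for the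
  next candidate \<open>m\<close>; 17 and 18 the result for \<open>\<alpha> = 0\<close>; \<open>30 + k\<close> holds \<open>plen k\<close>; 8 to 12 and 19
  are scratch.
\<close>

definition swap_line :: "instr list" where
  "swap_line =
    [(Direct 4, Monus, cell 2, cell 3),
     (Direct 5, Monus, cell 3, cell 2),
     (Direct 5, Plus, cell 4, cell 5),
     (Direct 4, Monus, cell 2, cell 4),
     (Direct 6, Plus, cell 4, Const 1),
     (Direct 12, Plus, cell 6, Const 0)]"

text \<open>One summand of \<open>plen_rec\<close>. Cell 11 holds the level minus
  \<open>shift j\<close>, positive exactly while piece \<open>j\<close> exists. Adding 29 gives the
  address of the entry for that piece, one level below this difference in a table that starts at
  cell 30.\<close>

definition sum_line :: "instr list" where
  "sum_line =
    [(Direct 11, Plus, cell 11, Const 29),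
     (Direct 8, Plus, cell 8, Cell (Indirect 11)),
     (Direct 9, Plus, cell 9, cell 1),
     (Direct 10, Div, cell 9, cell 0),
     (Direct 11, Monus, cell 7, cell 10)]"

definition table_body :: prog where
  "table_body =
    Seq (line
      [(Direct 7, Plus, cell 7, Const 1),
       (Direct 8, Plus, cell 7, Const 0),
       (Direct 9, Plus, cell 1, Const 0),
       (Direct 10, Div, cell 9, cell 0),
       (Direct 11, Monus, cell 7, cell 10)])
    (Seq (While (cell 11) (line sum_line))
    (line
      [(Direct 10, Plus, cell 7, Const 30),
       (Indirect 10, Plus, cell 8, Const 0),
       (Direct 12, Monus, cell 6, cell 8)]))"

text \<open>Tries to append the block whose level is given by the address \<open>30 + k\<close> in
  cell 10. The new index comes from the difference of two table entries, the new value of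
  \<open>xs\<close> from \<open>weight_block\<close>, and cell 12 is positive iff the new index
  still fits.\<close>

definition trial :: "instr list" where
  "trial =
    [(Direct 8, Plus, Cell (Indirect 10), Const 0),
     (Direct 11, Plus, cell 10, Const 1),
     (Direct 9, Monus, Cell (Indirect 11), cell 8),
     (Direct 9, Plus, cell 14, cell 9),
     (Direct 8, Times, cell 0, cell 8),
     (Direct 8, Plus, cell 1, cell 8),
     (Direct 8, Plus, cell 15, cell 8),
     (Direct 12, Times, cell 13, cell 9),
     (Direct 12, Plus, cell 12, cell 8),
     (Direct 12, Monus, cell 6, cell 12)]"

definition accept :: "instr list" where
  "accept = [(Direct 14, Plus, cell 9, Const 0), (Direct 15, Plus, cell 8, Const 0)]"

definition advance :: "instr list" where
  "advance = [(Direct 10, Div, cell 16, cell 0), (Direct 10, Monus, cell 7, cell 10)]"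

definition enter :: "instr list" where
  "enter = [(Direct 7, Monus, cell 10, Const 30), (Direct 16, Plus, cell 1, Const 0)]"

text \<open>The first loop accepts the blocks of the fixed word in order until one does not fit. The
  second works inside that block: it accepts a piece that fits and enters one that does not, until
  only a final letter is left.\<close>

definition search :: prog where
  "search =
    Seq (line ([(Direct 14, Plus, Const 0, Const 0), (Direct 15, Plus, Const 0, Const 0),
                (Direct 10, Plus, Const 30, Const 0)] @ trial))
    (Seq (While (cell 12) (line (accept @ (Direct 10, Plus, cell 10, Const 1) # trial)))
    (Seq (line (enter @ advance))
    (While (cell 10)
      (Seq (line ((Direct 10, Plus, cell 10, Const 29) # trial))
      (Seq (If (cell 12) (line (accept @ [(Direct 16, Plus, cell 16, cell 1)])) (line enter))
      (line advance))))))"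

text \<open>Truncated subtraction gives \<open>min d e\<close> as \<open>d - (d - e)\<close>, and
  absolute values as sums of two differences. Cell 11 ends up as \<open>0\<close> exactly for
  positions of even remoteness.\<close>

definition final_line :: "instr list" where
  "final_line =
    [(Direct 9, Div, cell 5, cell 0),
     (Direct 10, Monus, cell 9, cell 8),
     (Direct 9, Monus, cell 9, cell 10),
     (Direct 9, Plus, cell 9, cell 9),
     (Direct 9, Plus, cell 9, Const 1),
     (Direct 11, Times, cell 0, cell 17),
     (Direct 12, Monus, cell 5, cell 11),
     (Direct 11, Monus, cell 11, cell 5),
     (Direct 11, Plus, cell 11, cell 12),
     (Direct 12, Monus, cell 4, cell 18),
     (Direct 11, Plus, cell 11, cell 12)]"

definition wyt_prog :: prog where
  "wyt_prog =
    Seq (line swap_line)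
    (Seq (While (cell 12) table_body)
    (Seq (line [(Direct 13, Plus, Const 0, Const 0)])
    (Seq search
    (Seq (line [(Direct 17, Plus, cell 14, Const 0), (Direct 18, Plus, cell 15, Const 0),
                (Direct 13, Plus, cell 0, Const 0)])
    (Seq search
    (Seq (line
      [(Direct 19, Times, cell 13, cell 14),
       (Direct 19, Plus, cell 19, cell 15),
       (Direct 19, Plus, cell 19, cell 1),
       (Direct 19, Monus, cell 19, cell 4),
       (Direct 8, Plus, cell 17, Const 0)])
    (Seq (If (cell 19) (line [(Direct 8, Plus, cell 14, Const 0)]) (line []))
    (Seq (line final_line)
    (If (cell 11) (line [(Direct 0, Plus, cell 9, Const 0)])
      (line [(Direct 0, Plus, cell 17, cell 17)]))))))))))"

section \<open>Correctness of the program\<close>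

locale wyt_run = wyt +
  fixes lo dd :: nat
begin

text \<open>\<open>levels\<close> is the size of the table, \<open>bnd\<close> an upper bound for all cells during the run.\<close>

definition levels :: nat where
  "levels = (LEAST k. lo < plen k)"

definition room :: nat where
  "room = (a + 1) ^ 2 * (b + 1) * (lo + 1) * (dd + 1)"

definition bnd :: nat where
  "bnd = 100 * room"

lemma plen_levels: "lo < plen levels"
  unfolding levels_def using plen_ge[of "Suc lo"] LeastI[of "\<lambda>k. lo < plen k" "Suc lo"] by simp

lemma less_levels_iff: "k < levels \<longleftrightarrow> plen k \<le> lo"
  using not_less_Least[of k "\<lambda>k. lo < plen k"] plen_levels plen_mono[of levels k]
  unfolding levels_def[symmetric] by (meson le_trans not_le)

lemma levels_pos: "0 < levels"
  by (simp add: less_levels_iff)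

text \<open>The entry before the last is at most \<open>lo\<close>, and \<open>plen_Suc_le\<close>
  limits the last step.\<close>

lemma plen_levels_le: "plen levels \<le> (a + 1) * (lo + 1)"
proof -
  obtain k where k: "levels = Suc k" using levels_pos by (cases levels) auto
  then have "plen k \<le> lo" using less_levels_iff[of k] by simp
  then have "(a + 1) * plen k \<le> (a + 1) * lo" by (intro mult_le_mono) auto
  then show ?thesis using plen_Suc_le[of k] by (simp add: k)
qed

text \<open>The source of the polynomial running time: by \<open>plen_exp\<close> the table is long
  enough after \<open>b + 1\<close> levels per bit of \<open>lo + 1\<close>.\<close>

lemma levels_le: "lo + 1 < 2 ^ q \<Longrightarrow> levels \<le> q * (b + 1)"
  using plen_exp[of q] less_levels_iff[of "q * (b + 1)"] by linarith

lemma room_ge: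
  "1 \<le> room" "a \<le> room" "b \<le> room" "lo \<le> room" "dd \<le> room" "a * lo \<le> room"
  "plen levels \<le> room" "a * plen levels \<le> room" "levels * a * b \<le> room"
proof -
  have *: "u \<le> room" if "u \<le> p * q * r * s" "p \<le> (a + 1) ^ 2" "q \<le> b + 1" "r \<le> lo + 1" "s \<le> dd + 1"
    for u p q r s
    unfolding room_def using that by (meson le_trans mult_le_mono)
  have a2: "a + 1 \<le> (a + 1) ^ 2" "1 \<le> (a + 1) ^ 2" "a * (a + 1) \<le> (a + 1) ^ 2"
    by (simp_all add: power2_eq_square)
  show "1 \<le> room" by (rule *[of _ 1 1 1 1]) simp_all
  show "a \<le> room" by (rule *[of _ "a + 1" 1 1 1]) (use a2 in simp_all)
  show "b \<le> room" by (rule *[of _ 1 "b + 1" 1 1]) simp_all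
  show "lo \<le> room" by (rule *[of _ 1 1 "lo + 1" 1]) simp_all
  show "dd \<le> room" by (rule *[of _ 1 1 1 "dd + 1"]) simp_all
  show "a * lo \<le> room" by (rule *[of _ "a + 1" 1 "lo + 1" 1]) (use a2 in simp_all)
  show "plen levels \<le> room"
    by (rule *[of _ "a + 1" 1 "lo + 1" 1]) (use a2 plen_levels_le in simp_all)
  have 1: "a * plen levels \<le> a * (a + 1) * (lo + 1)"
    using mult_le_mono2[OF plen_levels_le, of a] by (simp only: mult.assoc)
  show "a * plen levels \<le> room"
    by (rule *[of _ "a * (a + 1)" 1 "lo + 1" 1]) (use a2 1 in simp_all)
  \<comment> \<open>Here \<open>levels\<close> is bounded crudely by \<open>plen levels\<close>;
    only the logarithm of \<open>room\<close> enters the running time.\<close>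
  have "levels * a \<le> a * (a + 1) * (lo + 1)"
    using 1 mult_le_mono2[OF plen_ge[of levels], of a] unfolding mult.commute[of levels a] by linarith
  then have "levels * a * b \<le> a * (a + 1) * (lo + 1) * (b + 1)"
    by (rule mult_le_mono) simp
  then have "levels * a * b \<le> a * (a + 1) * (b + 1) * (lo + 1) * 1"
    by (simp only: mult_ac mult_1_right)
  then show "levels * a * b \<le> room"
    by (rule *) (use a2 in simp_all)
qed

lemma room_plen:
  assumes "k \<le> levels"
  shows "k \<le> room" "plen k \<le> room" "a * plen k \<le> room"
proof -
  have "plen k \<le> plen levels" using assms by (rule plen_mono)
  moreover from this have "a * plen k \<le> a * plen levels" by simp
  ultimately show "k \<le> room" "plen k \<le> room" "a * plen k \<le> room"
    using room_ge(7,8) plen_ge[of k] by linarith+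
qed

lemma room_mult:
  assumes "k \<le> levels" "j \<le> nblocks k"
  shows "j * b \<le> room"
proof -
  have "j \<le> levels * a"
    using assms nblocks_le[of k] mult_le_mono1[OF assms(1), of a] by linarith
  then have "j * b \<le> levels * a * b" by simp
  then show ?thesis using room_ge(9) by linarith
qed

section \<open>Tabulating the block lengths\<close>

definition inputs :: "memory \<Rightarrow> bool" where
  "inputs m \<longleftrightarrow> m 0 = a \<and> m 1 = b \<and> m 4 = lo \<and> m 5 = dd \<and> m 6 = Suc lo"

definition table :: "nat \<Rightarrow> memory \<Rightarrow> bool" where
  "table k m \<longleftrightarrow> (\<forall>i\<le>k. m (30 + i) = plen i)"

definition table_inv :: "memory \<Rightarrow> bool" where
  "table_inv m \<longleftrightarrow> inputs m \<and> m 7 \<le> levels \<and> table (m 7) m \<and> m 12 = Suc lo - plen (m 7)"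

lemma wp_table_sum:
  assumes k: "Suc k \<le> levels"
    and m: "inputs m" "table k m" "m 7 = Suc k" "m 8 = Suc k" "m 9 = b" "m 11 = Suc k - shift 1"
  shows "wp bnd ((nblocks levels + 1) * (6 + 1)) (While (cell 11) (line sum_line))
     (\<lambda>m. inputs m \<and> table k m \<and> m 7 = Suc k \<and> m 8 = plen (Suc k)) m"
proof -
  \<comment> \<open>The partial sum before piece \<open>j\<close>. The invariant hides
    \<open>j\<close>; the variant recovers it as cell 9 divided by \<open>b\<close>.\<close>
  define S where "S j = Suc k + (\<Sum>i = 1..<j. plen (k - shift i))" for j
  define I where "I m \<longleftrightarrow> inputs m \<and> table k m \<and> m 7 = Suc k \<and>
    (\<exists>j. 1 \<le> j \<and> j \<le> Suc (nblocks (Suc k)) \<and> m 8 = S j \<and> m 9 = j * b \<and> m 11 = Suc k - shift j)"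
    for m :: memory
  have S_end: "S (Suc (nblocks (Suc k))) = plen (Suc k)"
    unfolding plen_rec[of "Suc k"] S_def by (simp add: atLeastLessThanSuc_atLeastAtMost)
  have S_le: "S j \<le> plen (Suc k)" if "j \<le> Suc (nblocks (Suc k))" for j
    unfolding S_end[symmetric] unfolding S_def using that by (intro add_left_mono sum_mono2) auto
  show ?thesis
  proof (rule wp_While[where I = I and V = "\<lambda>m. Suc (nblocks (Suc k)) - m 9 div b"])
    show "I m"
      unfolding I_def using m by (auto simp: S_def intro!: exI[of _ 1])
    show "Suc (nblocks (Suc k)) - m 9 div b \<le> nblocks levels"
      using m b_pos nblocks_mono[OF k] by simp
    show "operand_le bnd (cell 11)"
      using room_ge(1) by (simp add: bnd_def)
  next
    fix m assume I: "I m" and "operand_val m (cell 11) = 0"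
    then obtain j where j: "1 \<le> j" "j \<le> Suc (nblocks (Suc k))" "m 8 = S j" "\<not> shift j < Suc k"
      by (auto simp: I_def)
    then have "j = Suc (nblocks (Suc k))"
      using shift_less_iff[of j "Suc k"] by auto
    then show "inputs m \<and> table k m \<and> m 7 = Suc k \<and> m 8 = plen (Suc k)"
      using j I S_end by (simp add: I_def)
  next
    fix m assume "I m" and "operand_val m (cell 11) > 0"
    then obtain j where j: "1 \<le> j" "m 8 = S j" "m 9 = j * b"
      "m 11 = Suc k - shift j" and sh: "shift j < Suc k" and im: "inputs m" "table k m" "m 7 = Suc k"
      by (auto simp: I_def)
    then have jn: "j \<le> nblocks (Suc k)" using shift_less_iff[of j "Suc k"] by simp
    define q where "q = k - shift j"
    have "m (30 + q) = plen q"
      using im(2) unfolding table_def by (simp add: q_def)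
    moreover have "Suc (q + 29) = 30 + q" by simp
    ultimately have q: "m 11 = Suc q" "m (Suc (q + 29)) = plen q"
      using j sh by (simp_all only: q_def Suc_diff_le less_Suc_eq_le)
    have S_Suc: "S j + plen q = S (Suc j)"
      using j by (simp add: S_def q_def)
    have mb: "j * b + b = Suc j * b" "Suc j * b div a = shift (Suc j)"
      by (simp_all add: shift_def)
    let ?m = "m(11 := Suc k - shift (Suc j), 8 := S (Suc j), 9 := Suc j * b, 10 := shift (Suc j))"
    have bounds: "Suc (q + 29) \<le> bnd" "S (Suc j) \<le> bnd" "Suc j * b \<le> bnd" "30 \<le> bnd" "Suc k \<le> bnd"
      using room_plen[OF k] room_ge room_mult[OF k jn] S_le[of "Suc j"] jn
      unfolding bnd_def mult_Suc q_def by linarith+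
    have "shift (Suc j) \<le> bnd" "Suc k - shift (Suc j) \<le> bnd"
      using bounds(3,5) div_le_dividend[of "Suc j * b" a] unfolding shift_def by linarith+
    then have "exec bnd sum_line (\<lambda>m'. m' = ?m) m"
      using bounds j(2,3) im q S_Suc mb
      by (simp add: sum_line_def inputs_def fun_eq_iff del: mult_Suc)
    then have "wp bnd 6 (line sum_line) (\<lambda>m'. m' = ?m) m"
      by (rule wp_line) (simp add: sum_line_def)
    then show "wp bnd 6 (line sum_line)
      (\<lambda>m'. I m' \<and> Suc (nblocks (Suc k)) - m' 9 div b < Suc (nblocks (Suc k)) - m 9 div b) m"
    proof (rule wp_mono)
      fix m' assume m': "m' = ?m"
      have "I m'"
        unfolding I_def
        using im jn by (auto simp: m' inputs_def table_def intro!: exI[of _ "Suc j"])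
      moreover have "m' 9 div b = Suc j" "m 9 div b = j"
        using b_pos j by (simp_all add: m' del: mult_Suc)
      ultimately show "I m' \<and> Suc (nblocks (Suc k)) - m' 9 div b < Suc (nblocks (Suc k)) - m 9 div b"
        using jn by simp
    qed simp
  qed
qed

lemma wp_table_body:
  assumes inv: "table_inv m" and pos: "m 12 > 0"
  shows "wp bnd (6 + ((nblocks levels + 1) * (6 + 1) + 4)) table_body
    (\<lambda>m'. table_inv m' \<and> levels - m' 7 < levels - m 7) m"
proof -
  define k where "k = m 7"
  have kl: "k < levels"
    using inv pos by (simp add: table_inv_def less_levels_iff k_def)
  then have k: "Suc k \<le> levels" by simp
  have im: "inputs m" "table k m" "m 7 = k" using inv by (simp_all add: table_inv_def k_def)
  have bounds: "b \<le> bnd" "30 + Suc k \<le> bnd" "30 \<le> bnd" "Suc lo \<le> bnd" "plen (Suc k) \<le> bnd"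
    using room_plen[OF k] room_ge unfolding bnd_def by linarith+
  have sh: "shift 1 \<le> bnd"
    unfolding shift_def mult_1 using bounds(1) by (rule le_trans[OF div_le_dividend])
  have post: "wp bnd 4 (line
      [(Direct 10, Plus, cell 7, Const 30),
       (Indirect 10, Plus, cell 8, Const 0),
       (Direct 12, Monus, cell 6, cell 8)])
      (\<lambda>m'. table_inv m' \<and> levels - m' 7 < levels - m 7) m1"
    if m1: "inputs m1 \<and> table k m1 \<and> m1 7 = Suc k \<and> m1 8 = plen (Suc k)" for m1
  proof (rule wp_line)
    have "table (Suc k) (m1(10 := Suc k + 30, 30 + Suc k := plen (Suc k), 12 := Suc lo - plen (Suc k)))"
      using m1 by (auto simp: table_def le_Suc_eq)
    then show "exec bnd [(Direct 10, Plus, cell 7, Const 30),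
       (Indirect 10, Plus, cell 8, Const 0),
       (Direct 12, Monus, cell 6, cell 8)]
      (\<lambda>m'. table_inv m' \<and> levels - m' 7 < levels - m 7) m1"
      using m1 bounds kl im le_trans[OF diff_le_self bounds(4)] diff_less_mono2[OF lessI kl]
      by (simp add: inputs_def table_inv_def add.commute[of _ 30])
  qed simp
  have pre: "wp bnd 6 (line
      [(Direct 7, Plus, cell 7, Const 1),
       (Direct 8, Plus, cell 7, Const 0),
       (Direct 9, Plus, cell 1, Const 0),
       (Direct 10, Div, cell 9, cell 0),
       (Direct 11, Monus, cell 7, cell 10)])
      (\<lambda>m'. inputs m' \<and> table k m' \<and> m' 7 = Suc k \<and> m' 8 = Suc k \<and> m' 9 = b \<and> m' 11 = Suc k - shift 1) m"
    by (rule wp_line) (use im bounds sh in \<open>simp_all add: inputs_def table_def shift_def\<close>)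
  show ?thesis
    unfolding table_body_def
    by (rule wp_Seq, rule wp_mono[OF pre le_refl], rule wp_Seq, rule wp_mono[OF wp_table_sum[OF k] le_refl])
      (use post in auto)
qed

lemma wp_table:
  assumes "table_inv m"
  shows "wp bnd ((levels + 1) * (6 + ((nblocks levels + 1) * (6 + 1) + 4) + 1)) (While (cell 12) table_body)
    (\<lambda>m'. inputs m' \<and> table levels m') m"
proof (rule wp_While[where I = table_inv and V = "\<lambda>m. levels - m 7"])
  show "operand_le bnd (cell 12)"
    using room_ge(1) by (simp add: bnd_def)
  show "inputs m \<and> table levels m" if "table_inv m" "operand_val m (cell 12) = 0" for m
  proof -
    have "\<not> m 7 < levels" using that less_levels_iff[of "m 7"] by (auto simp: table_inv_def)
    then show ?thesis using that by (auto simp: table_inv_def)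
  qed
qed (use assms wp_table_body in auto)

section \<open>The greedy search through the blocks\<close>

lemma exec_trial:
  assumes "inputs m" "table levels m" "k < levels" "m 10 = 30 + k" "m 13 = \<alpha>" "\<alpha> = 0 \<or> \<alpha> = a"
    "m 14 = n" "m 15 = xs n" "n \<le> lo" "xs n \<le> lo"
    and Q: "Q (m(8 := xs n + (b + a * plen k), 11 := 31 + k, 9 := n + (plen (Suc k) - plen k),
      12 := Suc lo - (\<alpha> * (n + (plen (Suc k) - plen k)) + (xs n + (b + a * plen k)))))"
  shows "exec bnd trial Q m"
proof -
  have k: "k \<le> levels" "Suc k \<le> levels" using assms by auto
  have tab: "m (30 + k) = plen k" "m (31 + k) = plen (Suc k)"
    using assms(2) k by (simp_all add: table_def) (metis add_Suc_right add_Suc numeral_eq_Suc pred_numeral_simps(2) eval_nat_numeral(3))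
  define l where "l = plen (Suc k) - plen k"
  have al: "\<alpha> * n \<le> a * lo" "\<alpha> * l \<le> a * plen (Suc k)"
    using assms by (auto simp: l_def intro!: mult_le_mono)
  have l: "l \<le> plen (Suc k)" by (simp add: l_def)
  have bounds: "31 + k \<le> bnd" "l \<le> bnd" "n + l \<le> bnd" "plen k \<le> bnd" "31 \<le> bnd" "a * plen k \<le> bnd"
     "b + a * plen k \<le> bnd" "xs n + (b + a * plen k) \<le> bnd" "\<alpha> * n + \<alpha> * l \<le> bnd"
     "\<alpha> * n + \<alpha> * l + (xs n + (b + a * plen k)) \<le> bnd" "Suc lo \<le> bnd"
    using room_plen[OF k(1)] room_plen[OF k(2)] room_ge assms(9,10) al l
    unfolding bnd_def by linarith+
  show ?thesis
    using Q assms(1,4,5,7,8) tab bounds le_trans[OF diff_le_self bounds(11)] l_def[symmetric]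
    by (simp add: trial_def inputs_def add_mult_distrib2 fun_upd_twist)
qed

definition fits :: "nat \<Rightarrow> nat \<Rightarrow> bool" where
  "fits \<alpha> n \<longleftrightarrow> \<alpha> * n + xs n \<le> lo"

text \<open>Lists the work cells of a search; the inputs, the table and the stored results of an
  earlier search survive.\<close>

definition frame :: "memory \<Rightarrow> memory \<Rightarrow> bool" where
  "frame m0 m \<longleftrightarrow> (\<forall>i. i \<notin> {7, 8, 9, 10, 11, 12, 14, 15, 16} \<longrightarrow> m i = m0 i)"

definition tried :: "nat \<Rightarrow> nat \<Rightarrow> nat \<Rightarrow> memory \<Rightarrow> bool" where
  "tried \<alpha> n k m \<longleftrightarrow> m 9 = n + length (block k) \<and> m 8 = xs n + weight (block k) \<and>
     m 12 = Suc lo - (\<alpha> * (n + length (block k)) + (xs n + weight (block k)))"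

lemma tried_fits:
  assumes "occurs n (block k)" "tried \<alpha> n k m"
  shows "m 9 = n + length (block k)" "m 8 = xs (n + length (block k))"
    "0 < m 12 \<longleftrightarrow> fits \<alpha> (n + length (block k))"
  using assms by (auto simp: tried_def fits_def xs_occurs)

definition search_steps :: nat where
  "search_steps = 14 + ((levels + 1) * (14 + 1) + (5 +
     (levels * (levels * a + 2) + (levels * a + 2) + 1) * (12 + (1 + 4 + 3) + 1)))"

text \<open>A lexicographic order coded as a number: first the level, then the pieces left, counted
  from a common upper bound. By \<open>nblocks_Suc_le\<close> the factor of the level exceeds the
  second component.\<close>

definition descend_variant :: "memory \<Rightarrow> nat" where
  "descend_variant m = m 7 * (levels * a + 2) + (Suc (nblocks levels) - m 16 div b)"

lemma nblocks_Suc_le: "Suc (nblocks levels) < levels * a + 2"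
  using nblocks_le[of levels] by simp

context
  fixes m0 :: memory and \<alpha> :: nat
begin

definition scan_inv :: "memory \<Rightarrow> bool" where
  "scan_inv m \<longleftrightarrow> frame m0 m \<and> (\<exists>k. k < levels \<and> m 10 = 30 + k \<and> m 14 = plen k \<and>
     m 15 = xs (plen k) \<and> fits \<alpha> (plen k) \<and> tried \<alpha> (plen k) k m)"

text \<open>The bracketing invariant: the index sought lies between \<open>n\<close> and the end of
  the suffix that occurs there.\<close>

definition descend_state :: "nat \<Rightarrow> nat \<Rightarrow> nat \<Rightarrow> memory \<Rightarrow> bool" where
  "descend_state k j n m \<longleftrightarrow> frame m0 m \<and> k < levels \<and> 0 < j \<and> j \<le> Suc (nblocks k) \<and>
     m 7 = k \<and> m 16 = j * b \<and> m 14 = n \<and> m 15 = xs n \<and> fits \<alpha> n \<and>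
     occurs n (rest k j) \<and> \<not> fits \<alpha> (n + length (rest k j))"

definition descend_inv :: "memory \<Rightarrow> bool" where
  "descend_inv m \<longleftrightarrow> (\<exists>k j n. descend_state k j n m \<and> m 10 = k - shift j)"

definition found :: "memory \<Rightarrow> bool" where
  "found m \<longleftrightarrow> frame m0 m \<and> (\<exists>n. m 14 = n \<and> m 15 = xs n \<and> fits \<alpha> n \<and> \<not> fits \<alpha> (Suc n))"

context
  assumes m0: "inputs m0" "table levels m0" "m0 13 = \<alpha>" and \<alpha>: "\<alpha> = 0 \<or> \<alpha> = a"
begin

lemma frame_inputs: "frame m0 m \<Longrightarrow> inputs m" "frame m0 m \<Longrightarrow> table levels m" "frame m0 m \<Longrightarrow> m 13 = \<alpha>"
  using m0 by (auto simp: frame_def inputs_def table_def)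

lemma fits_le: "fits \<alpha> n \<Longrightarrow> n \<le> lo \<and> xs n \<le> lo"
  using xs_ge[of n] by (simp add: fits_def)

lemma exec_trial_frame:
  assumes "frame m0 m" "k < levels" "m 10 = 30 + k" "m 14 = n" "m 15 = xs n" "fits \<alpha> n"
    and "\<And>m'. frame m0 m' \<Longrightarrow> tried \<alpha> n k m' \<Longrightarrow> (\<And>i. i \<in> {7, 10, 14, 15, 16} \<Longrightarrow> m' i = m i) \<Longrightarrow> Q m'"
  shows "exec bnd trial Q m"
proof (rule exec_trial)
  show "Q (m(8 := xs n + (b + a * plen k), 11 := 31 + k, 9 := n + (plen (Suc k) - plen k),
      12 := Suc lo - (\<alpha> * (n + (plen (Suc k) - plen k)) + (xs n + (b + a * plen k)))))"
    using assms(1) by (intro assms(7)) (auto simp: frame_def tried_def length_block weight_block)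
qed (use assms frame_inputs fits_le \<alpha> in auto)

text \<open>Keeps the scan within the table, including the entry at \<open>Suc k\<close> that a
  trial reads.\<close>

lemma fits_plen_less: "fits \<alpha> (plen k) \<Longrightarrow> k < levels"
  using fits_le[of "plen k"] by (simp add: less_levels_iff)

lemma wp_scan:
  assumes "scan_inv m"
  shows "wp bnd ((levels + 1) * (14 + 1)) (While (cell 12) (line (accept @ (Direct 10, Plus, cell 10, Const 1) # trial)))
    (\<lambda>m'. scan_inv m' \<and> m' 12 = 0) m"
proof (rule wp_While[where I = scan_inv and V = "\<lambda>m. levels - (m 10 - 30)"])
  show "operand_le bnd (cell 12)"
    using room_ge(1) by (simp add: bnd_def)
next
  fix m assume inv: "scan_inv m" and "operand_val m (cell 12) > 0"
  then obtain k where k: "k < levels" "m 10 = 30 + k" "m 14 = plen k" "m 15 = xs (plen k)"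
    and t: "tried \<alpha> (plen k) k m" and pos: "m 12 > 0" and fr: "frame m0 m"
    by (auto simp: scan_inv_def)
  note t = tried_fits[OF occurs_block t, folded plen_Suc]
  have fits: "fits \<alpha> (plen (Suc k))" using t pos by simp
  have k': "Suc k < levels" using fits_plen_less[OF fits] .
  have bounds: "plen (Suc k) \<le> bnd" "xs (plen (Suc k)) \<le> bnd" "31 + k \<le> bnd" "14 \<le> bnd" "15 \<le> bnd"
    using fits_le[OF fits] room_plen[of "Suc k"] k' room_ge unfolding bnd_def by linarith+
  have "exec bnd (accept @ (Direct 10, Plus, cell 10, Const 1) # trial)
      (\<lambda>m'. scan_inv m' \<and> levels - (m' 10 - 30) < levels - (m 10 - 30)) m"
  proof -
    have "exec bnd trial (\<lambda>m'. scan_inv m' \<and> levels - (m' 10 - 30) < levels - (m 10 - 30))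
        (m(14 := plen (Suc k), 15 := xs (plen (Suc k)), 10 := 31 + k))"
      by (rule exec_trial_frame[where k = "Suc k" and n = "plen (Suc k)"])
        (use fr k k' fits in \<open>auto simp: frame_def scan_inv_def\<close>)
    then show ?thesis
      using k t bounds by (simp add: accept_def exec_append)
  qed
  then show "wp bnd 14 (line (accept @ (Direct 10, Plus, cell 10, Const 1) # trial))
      (\<lambda>m'. scan_inv m' \<and> levels - (m' 10 - 30) < levels - (m 10 - 30)) m"
    by (rule wp_line) (simp add: accept_def trial_def)
qed (use assms in auto)

lemma exec_advance:
  assumes "descend_state k j n m" "v = descend_variant m"
  shows "exec bnd advance (\<lambda>m'. descend_inv m' \<and> descend_variant m' = v) m"
proof -
  have st: "frame m0 m" "k < levels" "m 7 = k" "m 16 = j * b" "j \<le> Suc (nblocks k)"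
    using assms by (auto simp: descend_state_def)
  have jb: "j * b \<le> bnd" "k \<le> bnd" "16 \<le> bnd"
  proof -
    have "j - 1 \<le> nblocks k" using st by simp
    then have "(j - 1) * b \<le> room" using st by (intro room_mult) auto
    moreover have "j * b \<le> (j - 1) * b + b" by (cases j) auto
    ultimately show "j * b \<le> bnd" using room_ge unfolding bnd_def by linarith
    show "k \<le> bnd" "16 \<le> bnd" using room_plen[of k] st room_ge unfolding bnd_def by linarith+
  qed
  have sh: "shift j \<le> bnd"
    unfolding shift_def using jb(1) by (rule le_trans[OF div_le_dividend])
  have "descend_inv (m(10 := k - shift j))"
    unfolding descend_inv_def using assms
    by (intro exI[of _ k] exI[of _ j] exI[of _ n]) (auto simp: descend_state_def frame_def)
  moreover have "descend_variant (m(10 := k - shift j)) = v"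
    using assms by (simp add: descend_variant_def)
  ultimately show ?thesis
    using st frame_inputs[OF st(1)] jb sh
    by (simp add: advance_def inputs_def shift_def)
qed

lemma wp_descend:
  assumes "descend_inv m"
  shows "wp bnd ((levels * (levels * a + 2) + (levels * a + 2) + 1) * (12 + (1 + 4 + 3) + 1))
    (While (cell 10)
      (Seq (line ((Direct 10, Plus, cell 10, Const 29) # trial))
      (Seq (If (cell 12) (line (accept @ [(Direct 16, Plus, cell 16, cell 1)])) (line enter))
      (line advance)))) found m"
proof (rule wp_While[where I = descend_inv and V = descend_variant])
  show "operand_le bnd (cell 10)"
    using room_ge(1) by (simp add: bnd_def)
  show "descend_inv m" by fact
  show "descend_variant m \<le> levels * (levels * a + 2) + (levels * a + 2)"
  proof -
    have "m 7 \<le> levels" using assms by (auto simp: descend_inv_def descend_state_def)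
    then have "m 7 * (levels * a + 2) \<le> levels * (levels * a + 2)" by (rule mult_le_mono1)
    then show ?thesis using nblocks_Suc_le unfolding descend_variant_def by linarith
  qed
next
  fix m assume "descend_inv m" "operand_val m (cell 10) = 0"
  then obtain k j n where *: "descend_state k j n m" "\<not> shift j < k"
    by (auto simp: descend_inv_def)
  \<comment> \<open>Only the final letter is left, so the end of the suffix, which does not fit, is
    \<open>Suc n\<close>.\<close>
  then have "length (rest k j) = 1"
    by (intro length_rest_end) (auto simp: descend_state_def)
  then show "found m" using * by (auto simp: descend_state_def found_def)
next
  fix m assume "descend_inv m" "operand_val m (cell 10) > 0"
  then obtain k j n where st: "descend_state k j n m" and m10: "m 10 = k - shift j" and sh: "shift j < k"
    by (auto simp: descend_inv_def)
  define l where "l = k - 1 - shift j"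
  have m10': "m 10 + 29 = 30 + l" using m10 sh by (simp add: l_def)
  have st': "frame m0 m" "k < levels" "m 7 = k" "m 16 = j * b" "m 14 = n" "m 15 = xs n" "fits \<alpha> n" "0 < j"
    "occurs n (rest k j)" "\<not> fits \<alpha> (n + length (rest k j))"
    using st by (auto simp: descend_state_def)
  have jn: "j \<le> nblocks k" using sh st' shift_less_iff by simp
  have l: "l < k" "l < levels" using st' sh by (auto simp: l_def)
  have rest: "rest k j = block l @ rest k (Suc j)"
    unfolding l_def using st' sh by (intro rest_step) auto
  have occ: "occurs n (block l)" "occurs (n + length (block l)) (rest k (Suc j))"
    using st' by (simp_all add: rest occurs_append)
  let ?v = "descend_variant m"
  have v: "?v = k * (levels * a + 2) + (Suc (nblocks levels) - j)"
    using st' b_pos by (simp add: descend_variant_def)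
  have jl: "j < Suc (nblocks levels)" using jn nblocks_mono[of k levels] st' by simp
  let ?P = "\<lambda>m'. frame m0 m' \<and> tried \<alpha> n l m' \<and> (\<forall>i\<in>{7, 14, 15, 16}. m' i = m i) \<and> m' 10 = 30 + l"
  let ?R = "\<lambda>m'. \<exists>k j n. descend_state k j n m' \<and> descend_variant m' < ?v"
  have bounds: "30 + l \<le> bnd" "30 \<le> bnd" "n \<le> bnd" "xs n \<le> bnd" "Suc j * b \<le> bnd" "b \<le> bnd" "l \<le> bnd"
    using room_plen[of l] l fits_le[OF st'(7)] room_ge room_mult[of k j] jn st'(2)
    unfolding bnd_def mult_Suc by linarith+
  have step: "wp bnd (1 + 4) (If (cell 12) (line (accept @ [(Direct 16, Plus, cell 16, cell 1)])) (line enter)) ?R m1"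
    if m1: "?P m1" for m1
  proof (rule wp_If)
    note t = tried_fits[OF occ(1), of \<alpha> m1]
    have im: "inputs m1" using m1 frame_inputs by blast
    show "operand_le bnd (cell 12)" using bounds by simp
    show "wp bnd 4 (line (accept @ [(Direct 16, Plus, cell 16, cell 1)])) ?R m1"
      if "operand_val m1 (cell 12) > 0"
    proof (rule wp_line)
      let ?n = "n + length (block l)"
      let ?m = "m1(14 := ?n, 15 := xs ?n, 16 := Suc j * b)"
      have fits: "fits \<alpha> ?n" using t m1 that by simp
      have "descend_state k (Suc j) ?n ?m"
        using st' m1 fits occ jn unfolding descend_state_def
        by (auto simp: rest frame_def add.assoc)
      moreover have "descend_variant ?m < ?v"
        unfolding v using st' m1 b_pos jl
        by (simp add: descend_variant_def del: mult_Suc)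
      ultimately have "?R ?m" by blast
      moreover have "?n \<le> bnd" "xs ?n \<le> bnd"
        using fits_le[OF fits] room_ge unfolding bnd_def by linarith+
      ultimately show "exec bnd (accept @ [(Direct 16, Plus, cell 16, cell 1)]) ?R m1"
        using t m1 st' im bounds by (simp add: accept_def inputs_def add.commute[of b])
    qed (simp add: accept_def)
    show "wp bnd 4 (line enter) ?R m1" if "operand_val m1 (cell 12) = 0"
    proof (rule wp_line)
      let ?m = "m1(7 := l, 16 := b)"
      have nfits: "\<not> fits \<alpha> (n + length (block l))" using t m1 that by simp
      have "descend_state l 1 n ?m"
        using st' m1 nfits occ l unfolding descend_state_def
        by (auto simp: frame_def block_rest[of l])
      moreover have "descend_variant ?m < ?v"
      proof -
        \<comment> \<open>Entering a piece lowers the level, which pays for resetting the count of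
          pieces.\<close>
        have "Suc l * (levels * a + 2) \<le> k * (levels * a + 2)"
          using l by (intro mult_le_mono1) simp
        then show ?thesis
          unfolding v using nblocks_Suc_le b_pos by (simp add: descend_variant_def)
      qed
      ultimately have "?R ?m" by blast
      then show "exec bnd enter ?R m1"
        using m1 im bounds by (simp add: enter_def inputs_def)
    qed (simp add: enter_def)
  qed
  have "exec bnd ((Direct 10, Plus, cell 10, Const 29) # trial) ?P m"
  proof -
    have "exec bnd trial ?P (m(10 := 30 + l))"
      by (rule exec_trial_frame[where k = l and n = n]) (use st' l in \<open>auto simp: frame_def\<close>)
    then show ?thesis using m10' bounds by simp
  qed
  then have 1: "wp bnd 12 (line ((Direct 10, Plus, cell 10, Const 29) # trial)) ?P m"
    by (rule wp_line) (simp add: trial_def)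
  have 2: "wp bnd 3 (line advance) (\<lambda>m'. descend_inv m' \<and> descend_variant m' < ?v) m2" if "?R m2" for m2
  proof -
    obtain k j n where s: "descend_state k j n m2" "descend_variant m2 < ?v" using \<open>?R m2\<close> by blast
    have "wp bnd 3 (line advance)
        (\<lambda>m'. descend_inv m' \<and> descend_variant m' = descend_variant m2) m2"
      using exec_advance[OF s(1) refl] by (rule wp_line) (simp add: advance_def)
    then show ?thesis
      by (rule wp_mono) (use s(2) in auto)
  qed
  show "wp bnd (12 + (1 + 4 + 3)) (Seq (line ((Direct 10, Plus, cell 10, Const 29) # trial))
      (Seq (If (cell 12) (line (accept @ [(Direct 16, Plus, cell 16, cell 1)])) (line enter))
      (line advance))) (\<lambda>m'. descend_inv m' \<and> descend_variant m' < ?v) m"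
  proof (intro wp_Seq wp_mono[OF 1])
    fix m1 assume "?P m1"
    show "wp bnd (1 + 4) (If (cell 12) (line (accept @ [(Direct 16, Plus, cell 16, cell 1)])) (line enter))
      (wp bnd 3 (line advance) (\<lambda>m'. descend_inv m' \<and> descend_variant m' < ?v)) m1"
      by (rule wp_mono[OF step[OF \<open>?P m1\<close>] _ 2]) simp_all
  qed simp
qed

lemma wp_search: "wp bnd search_steps search found m0"
proof -
  have "exec bnd ([(Direct 14, Plus, Const 0, Const 0), (Direct 15, Plus, Const 0, Const 0),
      (Direct 10, Plus, Const 30, Const 0)] @ trial) scan_inv m0"
  proof -
    have fits: "fits \<alpha> 0" by (simp add: fits_def)
    have "exec bnd trial scan_inv (m0(14 := 0, 15 := 0, 10 := 30))"
      by (rule exec_trial_frame[where k = 0 and n = 0])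
        (use levels_pos fits in \<open>auto simp: frame_def scan_inv_def\<close>)
    then show ?thesis using room_ge(1) by (simp add: bnd_def)
  qed
  then have 1: "wp bnd 14 (line ([(Direct 14, Plus, Const 0, Const 0),
      (Direct 15, Plus, Const 0, Const 0), (Direct 10, Plus, Const 30, Const 0)] @ trial)) scan_inv m0"
    by (rule wp_line) (simp add: trial_def)
  have 2: "wp bnd 5 (line (enter @ advance)) descend_inv m" if m: "scan_inv m \<and> m 12 = 0" for m
  proof -
    obtain k where k: "k < levels" "m 10 = 30 + k" "m 14 = plen k" "m 15 = xs (plen k)"
      "fits \<alpha> (plen k)" and t: "tried \<alpha> (plen k) k m" and fr: "frame m0 m"
      using m by (auto simp: scan_inv_def)
    have nfits: "\<not> fits \<alpha> (plen k + length (block k))"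
      using tried_fits[OF occurs_block t] m by simp
    let ?m = "m(7 := k, 16 := b)"
    have "descend_state k 1 (plen k) ?m"
      using k fr nfits occurs_block[of k] unfolding descend_state_def
      by (auto simp: frame_def block_rest[of k])
    from exec_advance[OF this refl]
    have adv: "exec bnd advance (\<lambda>m'. descend_inv m' \<and> descend_variant m' = descend_variant ?m) ?m" .
    have bounds: "k \<le> bnd" "b \<le> bnd" "30 \<le> bnd"
      using room_plen[of k] k room_ge unfolding bnd_def by linarith+
    have "exec bnd (enter @ advance) (\<lambda>m'. descend_inv m' \<and> descend_variant m' = descend_variant ?m) m"
      using adv k bounds frame_inputs[OF fr] by (simp add: enter_def inputs_def)
    then have "wp bnd 5 (line (enter @ advance))
        (\<lambda>m'. descend_inv m' \<and> descend_variant m' = descend_variant ?m) m"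
      by (rule wp_line) (simp add: enter_def advance_def)
    then show ?thesis by (rule wp_mono) auto
  qed
  show ?thesis
    unfolding search_def search_steps_def
    by (rule wp_Seq, rule wp_mono[OF 1 le_refl], rule wp_Seq, rule wp_mono[OF wp_scan le_refl], assumption,
        rule wp_Seq, rule wp_mono[OF 2 le_refl], assumption, rule wp_descend)
qed

end

end

section \<open>Evaluating the remoteness formula from the two search results\<close>

definition searched :: "nat \<Rightarrow> nat \<Rightarrow> memory \<Rightarrow> bool" where
  "searched i j m \<longleftrightarrow> inputs m \<and> max_below xs lo i \<and> max_below ys lo j \<and>
     m 13 = a \<and> m 14 = j \<and> m 15 = xs j \<and> m 17 = i \<and> m 18 = xs i"

definition result :: "nat \<Rightarrow> nat \<Rightarrow> nat" where
  "result i j = (if lo = xs i \<and> lo + dd = ys i then 2 * i else 1 + 2 * entry lo (lo + dd) i j)"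

lemma wp_final:
  assumes "searched i j m"
  shows "wp bnd (6 + ((1 + 2) + (12 + (1 + 2))))
    (Seq (line
      [(Direct 19, Times, cell 13, cell 14),
       (Direct 19, Plus, cell 19, cell 15),
       (Direct 19, Plus, cell 19, cell 1),
       (Direct 19, Monus, cell 19, cell 4),
       (Direct 8, Plus, cell 17, Const 0)])
    (Seq (If (cell 19) (line [(Direct 8, Plus, cell 14, Const 0)]) (line []))
    (Seq (line final_line)
    (If (cell 11) (line [(Direct 0, Plus, cell 9, Const 0)])
      (line [(Direct 0, Plus, cell 17, cell 17)])))))
    (\<lambda>m'. m' 0 = result i j) m"
proof -
  define d e f where "d = dd div a" and "e = (if lo < ys j + b then j else i)"
    and "f = a * i - dd + (dd - a * i) + (lo - xs i)"
  have im: "inputs m" "m 13 = a" "m 14 = j" "m 15 = xs j" "m 17 = i" "m 18 = xs i"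
    and ij: "ys j \<le> lo" "xs i \<le> lo"
    using assms by (auto simp: searched_def max_below_def)
  have le: "j \<le> lo" "xs j \<le> lo" "i \<le> lo" "a * j \<le> lo" "a * i \<le> a * lo" "e \<le> lo" "d \<le> dd"
    using ij xs_ge[of i] xs_ge[of j] by (auto simp: ys_def e_def d_def)
  have f0: "f = 0 \<longleftrightarrow> lo = xs i \<and> lo + dd = ys i"
    using ij(2) by (auto simp: f_def ys_def)
  have res: "result i j = (if f = 0 then i + i else Suc (min d e + min d e))"
    unfolding result_def f0 entry_def d_def e_def by simp
  have bounds: "a * j \<le> bnd" "a * j + xs j \<le> bnd" "a * j + xs j + b \<le> bnd" "30 \<le> bnd"
    "i \<le> bnd" "j \<le> bnd" "d \<le> bnd" "Suc (min d e + min d e) \<le> bnd" "i + i \<le> bnd" "e \<le> bnd"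
    "min d e + min d e \<le> bnd" "min d e \<le> bnd" "a * i \<le> bnd"
    "a * i - dd + (dd - a * i) \<le> bnd" "f \<le> bnd" "xs i \<le> bnd" "lo \<le> bnd" "dd \<le> bnd"
    using room_ge le ij unfolding bnd_def f_def by linarith+
  have diffs: "u - v \<le> bnd" if "u \<le> bnd" for u v
    using that by simp
  define P where "P m' \<longleftrightarrow> inputs m' \<and> m' 14 = j \<and> m' 17 = i \<and> m' 18 = xs i" for m' :: memory
  have 1: "wp bnd 6 (line
      [(Direct 19, Times, cell 13, cell 14),
       (Direct 19, Plus, cell 19, cell 15),
       (Direct 19, Plus, cell 19, cell 1),
       (Direct 19, Monus, cell 19, cell 4),
       (Direct 8, Plus, cell 17, Const 0)])
      (\<lambda>m'. P m' \<and> m' 8 = i \<and> (0 < m' 19 \<longleftrightarrow> lo < ys j + b)) m"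
    by (rule wp_line) (use im bounds diffs[OF bounds(3), of lo] in
      \<open>auto simp: inputs_def P_def ys_def add.commute\<close>)
  have 2: "wp bnd (1 + 2) (If (cell 19) (line [(Direct 8, Plus, cell 14, Const 0)]) (line []))
      (\<lambda>m'. P m' \<and> m' 8 = e) m'" if "P m' \<and> m' 8 = i \<and> (0 < m' 19 \<longleftrightarrow> lo < ys j + b)" for m'
  proof (rule wp_If)
    show "wp bnd 2 (line [(Direct 8, Plus, cell 14, Const 0)]) (\<lambda>m'. P m' \<and> m' 8 = e) m'"
      if "0 < operand_val m' (cell 19)"
      by (rule wp_line) (use that \<open>P m' \<and> _\<close> bounds in \<open>auto simp: P_def inputs_def e_def\<close>)
    show "wp bnd 2 (line []) (\<lambda>m'. P m' \<and> m' 8 = e) m'"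
      if "operand_val m' (cell 19) = 0"
      by (rule wp_line) (use that \<open>P m' \<and> _\<close> in \<open>auto simp: e_def\<close>)
  qed (use bounds in simp)
  have 3: "wp bnd 12 (line final_line) (\<lambda>m'. m' 17 = i \<and> m' 9 = Suc (min d e + min d e) \<and> m' 11 = f) m'"
    if "P m' \<and> m' 8 = e" for m'
  proof (rule wp_line)
    have md: "d - (d - e) = min d e" by simp
    show "exec bnd final_line (\<lambda>m'. m' 17 = i \<and> m' 9 = Suc (min d e + min d e) \<and> m' 11 = f) m'"
      using that bounds diffs[OF bounds(7), of e] diffs[OF bounds(18), of "a * i"]
        diffs[OF bounds(13), of dd] diffs[OF bounds(17), of "xs i"] md
      by (simp add: final_line_def P_def inputs_def f_def d_def[symmetric])
  qed (simp add: final_line_def)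
  have 4: "wp bnd (1 + 2) (If (cell 11) (line [(Direct 0, Plus, cell 9, Const 0)])
      (line [(Direct 0, Plus, cell 17, cell 17)])) (\<lambda>m'. m' 0 = result i j) m'"
    if "m' 17 = i \<and> m' 9 = Suc (min d e + min d e) \<and> m' 11 = f" for m'
  proof (rule wp_If)
    show "wp bnd 2 (line [(Direct 0, Plus, cell 9, Const 0)]) (\<lambda>m'. m' 0 = result i j) m'"
      if "0 < operand_val m' (cell 11)"
      by (rule wp_line) (use that \<open>m' 17 = i \<and> _\<close> bounds res in auto)
    show "wp bnd 2 (line [(Direct 0, Plus, cell 17, cell 17)]) (\<lambda>m'. m' 0 = result i j) m'"
      if "operand_val m' (cell 11) = 0"
      by (rule wp_line) (use that \<open>m' 17 = i \<and> _\<close> bounds res in auto)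
  qed (use bounds in simp)
  show ?thesis
    by (intro wp_Seq wp_mono[OF 1 le_refl])
      (rule wp_mono[OF 2 le_refl], assumption, rule wp_Seq, rule wp_mono[OF 3 le_refl], assumption, rule 4)
qed

text \<open>The weight \<open>0\<close> makes the search run over \<open>xs\<close>, and the weight
  \<open>a\<close> makes it run over \<open>ys\<close>, so one routine serves both.\<close>

lemma max_below_fits:
  "fits 0 n \<Longrightarrow> \<not> fits 0 (Suc n) \<Longrightarrow> max_below xs lo n"
  "fits a n \<Longrightarrow> \<not> fits a (Suc n) \<Longrightarrow> max_below ys lo n"
  by (simp_all add: fits_def max_below_def ys_def add.commute)

definition prog_steps :: nat where
  "prog_steps = 7 + ((levels + 1) * (6 + ((nblocks levels + 1) * (6 + 1) + 4) + 1) +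
     (2 + (search_steps + (4 + (search_steps + (6 + ((1 + 2) + (12 + (1 + 2)))))))))"

lemma wp_wyt_prog:
  assumes xy: "lo = min x y" "lo + dd = max x y"
  shows "wp bnd prog_steps wyt_prog (\<lambda>m. m 0 = remoteness a b (x, y)) (init_memory [a, b, x, y])"
proof -
  let ?m = "init_memory [a, b, x, y]"
  let ?R = "\<lambda>m. m 0 = remoteness a b (x, y)"
  have init: "?m 0 = a" "?m (Suc 0) = b" "?m 2 = x" "?m 3 = y" "\<And>i. 3 < i \<Longrightarrow> ?m i = 0"
    by (auto simp: init_memory_def nth_Cons' numeral_eq_Suc)
  have R: "result i j = remoteness a b (x, y)" if "max_below xs lo i" "max_below ys lo j" for i j
  proof -
    have "remoteness a b (lo, lo + dd) = remoteness a b (x, y)"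
      unfolding xy(2) unfolding xy(1)
      using remoteness_swap[of "(x, y)"] by (auto simp: min_def max_def)
    then show ?thesis
      using remoteness_formula[OF _ that, of "lo + dd"] by (simp add: result_def)
  qed
  have bounds: "30 \<le> bnd" "x \<le> bnd" "y \<le> bnd" "Suc lo \<le> bnd" "a \<le> bnd"
    using room_ge xy unfolding bnd_def by linarith+
  have 1: "wp bnd 7 (line swap_line) table_inv ?m"
  proof (rule wp_line)
    have "x - y + (y - x) = dd" "x - (x - y) = lo" using xy by linarith+
    moreover have "x - y \<le> bnd" "y - x \<le> bnd" "dd \<le> bnd" "lo \<le> bnd"
      using bounds xy by linarith+
    ultimately show "exec bnd swap_line table_inv ?m"
      using init bounds by (simp add: swap_line_def table_inv_def inputs_def table_def)
  qed (simp add: swap_line_def)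
  have 2: "wp bnd 2 (line [(Direct 13, Plus, Const 0, Const 0)])
      (\<lambda>m'. inputs m' \<and> table levels m' \<and> m' 13 = 0) m" if "inputs m \<and> table levels m" for m
    by (rule wp_line) (use that bounds in \<open>auto simp: inputs_def table_def\<close>)
  have 3: "wp bnd search_steps search (\<lambda>m'. \<exists>i. inputs m' \<and> table levels m' \<and> max_below xs lo i \<and>
      m' 14 = i \<and> m' 15 = xs i) m"
    if "inputs m \<and> table levels m \<and> m 13 = 0" for m
  proof (rule wp_mono[OF wp_search[where \<alpha> = 0] le_refl])
    fix m' assume "found m 0 m'"
    then show "\<exists>i. inputs m' \<and> table levels m' \<and> max_below xs lo i \<and> m' 14 = i \<and> m' 15 = xs i"
      using that frame_inputs[of m 0 m'] max_below_fits(1) unfolding found_def by auto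
  qed (use that in auto)
  have 4: "wp bnd 4 (line [(Direct 17, Plus, cell 14, Const 0), (Direct 18, Plus, cell 15, Const 0),
                (Direct 13, Plus, cell 0, Const 0)])
      (\<lambda>m'. \<exists>i. inputs m' \<and> table levels m' \<and> max_below xs lo i \<and> m' 13 = a \<and> m' 17 = i \<and> m' 18 = xs i) m"
    if ex: "\<exists>i. inputs m \<and> table levels m \<and> max_below xs lo i \<and> m 14 = i \<and> m 15 = xs i" for m
  proof (rule wp_line)
    obtain i where i: "inputs m" "table levels m" "max_below xs lo i" "m 14 = i" "m 15 = xs i"
      using ex by blast
    then have "xs i \<le> bnd" "i \<le> bnd"
      using bounds xs_ge[of i] unfolding max_below_def by linarith+
    then show "exec bnd [(Direct 17, Plus, cell 14, Const 0), (Direct 18, Plus, cell 15, Const 0),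
                (Direct 13, Plus, cell 0, Const 0)]
      (\<lambda>m'. \<exists>i. inputs m' \<and> table levels m' \<and> max_below xs lo i \<and> m' 13 = a \<and> m' 17 = i \<and> m' 18 = xs i) m"
      using i bounds by (simp add: inputs_def table_def)
  qed simp
  have 5: "wp bnd search_steps search (\<lambda>m'. \<exists>i j. searched i j m') m"
    if "\<exists>i. inputs m \<and> table levels m \<and> max_below xs lo i \<and> m 13 = a \<and> m 17 = i \<and> m 18 = xs i" for m
  proof (rule wp_mono[OF wp_search[where \<alpha> = a] le_refl])
    fix m' assume f: "found m a m'"
    then have fr: "frame m m'" by (simp add: found_def)
    then have "m' 17 = m 17" "m' 18 = m 18" by (simp_all add: frame_def)
    then show "\<exists>i j. searched i j m'"
      using that f frame_inputs[OF _ _ _ _ fr, of a] max_below_fits(2) unfolding found_def searched_def by auto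
  qed (use that in auto)
  have 6: "wp bnd (6 + ((1 + 2) + (12 + (1 + 2))))
    (Seq (line
      [(Direct 19, Times, cell 13, cell 14),
       (Direct 19, Plus, cell 19, cell 15),
       (Direct 19, Plus, cell 19, cell 1),
       (Direct 19, Monus, cell 19, cell 4),
       (Direct 8, Plus, cell 17, Const 0)])
    (Seq (If (cell 19) (line [(Direct 8, Plus, cell 14, Const 0)]) (line []))
    (Seq (line final_line)
    (If (cell 11) (line [(Direct 0, Plus, cell 9, Const 0)])
      (line [(Direct 0, Plus, cell 17, cell 17)])))))
    ?R m" if ex: "\<exists>i j. searched i j m" for m
  proof -
    obtain i j where ij: "searched i j m" using ex by blast
    then have "result i j = remoteness a b (x, y)" using R by (simp add: searched_def)
    then show ?thesis using wp_final[OF ij] by simp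
  qed
  show ?thesis
    unfolding wyt_prog_def prog_steps_def
    apply (rule wp_Seq, rule wp_mono[OF 1 le_refl])
    apply (rule wp_Seq, rule wp_mono[OF wp_table le_refl], assumption)
    apply (rule wp_Seq, rule wp_mono[OF 2 le_refl], assumption)
    apply (rule wp_Seq, rule wp_mono[OF 3 le_refl], assumption)
    apply (rule wp_Seq, rule wp_mono[OF 4 le_refl], assumption)
    apply (rule wp_Seq, rule wp_mono[OF 5 le_refl], assumption)
    apply (rule 6, assumption)
    done
qed

lemma computes_wyt_prog:
  assumes xy: "lo = min x y" "lo + dd = max x y"
  shows "computes_within wyt_prog [a, b, x, y] (remoteness a b (x, y)) (real (prog_steps * (8 * bit_len bnd)))"
proof -
  have "bounded bnd (init_memory [a, b, x, y])"
  proof -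
    have "a \<le> bnd" "b \<le> bnd" "x \<le> bnd" "y \<le> bnd"
      using room_ge xy unfolding bnd_def by linarith+
    then show ?thesis by (auto simp: bounded_def init_memory_def nth_Cons' numeral_eq_Suc)
  qed
  then show ?thesis
    using wp_wyt_prog[OF assms] unfolding wp_def computes_within_def of_nat_le_iff by blast
qed

end

section \<open>Polynomial bound\<close>

lemma bit_len_le_log: "n > 0 \<Longrightarrow> real (bit_len n) \<le> 1 + log 2 n"
proof -
  assume n: "n > 0"
  then have "0 \<le> log 2 (real n)" by simp
  then have "real (floorlog 2 n) \<le> 1 + log 2 n"
    using n by (simp add: floorlog_def)
  moreover have "1 \<le> floorlog 2 n" using n by (simp add: floorlog_def)
  ultimately show ?thesis by (simp add: bit_len_def)
qed

text \<open>A linear bound is enough for \<open>a\<close> and \<open>b\<close>, as the time may be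
  polynomial in their values.\<close>

lemma log2_le: "log 2 (real (n + 1)) \<le> 1 + real n"
proof -
  have "n + 1 \<le> 2 ^ n" using less_exp[of n] by (simp add: Suc_leI)
  then have "real (n + 1) \<le> 2 ^ n" by (metis of_nat_le_iff of_nat_numeral of_nat_power)
  then have "log 2 (real (n + 1)) \<le> log 2 (2 ^ n)" by (subst log_le_cancel_iff) auto
  then show ?thesis by simp
qed

text \<open>Brings a compact power bound into the required form by one binomial expansion per
  variable.\<close>

lemma poly3_binomial:
  "poly3 n (\<lambda>i j k. C * real (n choose i) * real (n choose j) * real (n choose k)) u v w =
    C * ((u + 1) * (v + 1) * (w + 1)) ^ n"
proof -
  have pow: "(t + 1) ^ n = (\<Sum>i\<le>n. real (n choose i) * t ^ i)" for t :: real
    using binomial_ring[of t 1 n] by simp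
  have prod: "(\<Sum>i\<le>n. f i) * ((\<Sum>j\<le>n. g j) * (\<Sum>k\<le>n. h k)) =
      (\<Sum>i\<le>n. \<Sum>j\<le>n. \<Sum>k\<le>n. f i * (g j * h k))" for f g h :: "nat \<Rightarrow> real"
    by (simp only: sum_product) (simp only: sum_distrib_left)
  show ?thesis
    unfolding poly3_def power_mult_distrib pow mult.assoc prod
    unfolding sum_distrib_left by (simp only: mult_ac)
qed

context wyt_run
begin

text \<open>Everything is measured in \<open>Z\<close>, the product of the three factors: at most
  \<open>960 * Z ^ 3\<close> steps, each costing at most eight times the bit length of
  \<open>bnd\<close>, which is at most \<open>13 * Z\<close>.\<close>

lemma prog_time_le:
  assumes xy: "lo = min x y" "lo + dd = max x y"
  shows "real (prog_steps * (8 * bit_len bnd)) \<le>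
    100000 * ((real a + 1) * (real b + 1) * (log_size x y + 1)) ^ 4"
proof -
  define A B W where "A = real a + 1" and "B = real b + 1" and "W = log_size x y + 1"
  define Z where "Z = A * B * W"
  have W: "1 \<le> W"
  proof -
    have "1 \<le> max 1 x * max 1 y" by simp
    then have "real 1 \<le> real (max 1 x * max 1 y)" by (simp only: of_nat_le_iff)
    then have "0 \<le> log 2 (real (max 1 x * max 1 y))"
      unfolding of_nat_1 by (subst zero_le_log_cancel_iff) auto
    then show ?thesis unfolding W_def log_size_def by linarith
  qed
  have AB: "1 \<le> A" "1 \<le> B" by (simp_all add: A_def B_def)
  have prods: "1 \<le> A * B" "1 \<le> A * W" "1 \<le> B * W"
    using AB W mult_mono[of 1 A 1 B] mult_mono[of 1 A 1 W] mult_mono[of 1 B 1 W] by simp_all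
  have Z: "1 \<le> Z" "A \<le> Z" "B * W \<le> Z" "B \<le> Z" "W \<le> Z"
  proof -
    show "W \<le> Z" using mult_right_mono[OF prods(1), of W] W by (simp add: Z_def)
    then show "1 \<le> Z" using W by simp
    show "A \<le> Z" using mult_left_mono[OF prods(3), of A] AB by (simp add: Z_def mult.assoc)
    show "B \<le> Z" using mult_left_mono[OF prods(2), of B] AB by (simp add: Z_def mult_ac)
    show "B * W \<le> Z" using mult_right_mono[OF AB(1), of "B * W"] prods by (simp add: Z_def mult.assoc)
  qed
  have logs: "log 2 (real (v + 1)) \<le> W" if "v \<le> max 1 x * max 1 y" for v
  proof -
    let ?p = "max 1 x * max 1 y"
    have "1 \<le> ?p" by simp
    \<comment> \<open>Doubling costs one bit, which is the summand \<open>1\<close> in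
      \<open>W\<close>.\<close>
    then have "v + 1 \<le> 2 * ?p" using that by linarith
    then have "real (v + 1) \<le> 2 * real ?p" by (metis of_nat_le_iff of_nat_mult of_nat_numeral)
    then have "log 2 (real (v + 1)) \<le> log 2 (2 * real ?p)" by (subst log_le_cancel_iff) auto
    also have "\<dots> = W" by (subst log_mult) (auto simp: W_def log_size_def)
    finally show ?thesis .
  qed
  have le_prod: "max x y \<le> max 1 x * max 1 y"
    using mult_le_mono[of "max 1 x" "max 1 x" 1 "max 1 y"] mult_le_mono[of 1 "max 1 x" "max 1 y" "max 1 y"] by auto
  have logs': "log 2 (real (lo + 1)) \<le> W" "log 2 (real (dd + 1)) \<le> W"
    using le_prod xy by (intro logs; linarith)+
  have L: "real levels \<le> 2 * Z"
  proof -
    let ?q = "bit_len (lo + 1)"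
    have "lo + 1 < 2 ^ ?q"
      using floorlog_bounds[of "lo + 1" 2] by (simp add: bit_len_def floorlog_def)
    then have "levels \<le> ?q * (b + 1)" by (rule levels_le)
    then have "real levels \<le> real ?q * B" unfolding B_def by (metis of_nat_1 of_nat_add of_nat_le_iff of_nat_mult)
    also have "\<dots> \<le> (2 * W) * B"
      using bit_len_le_log[of "lo + 1"] logs'(1) W AB by (intro mult_right_mono) auto
    also have "\<dots> \<le> 2 * Z" using Z(3) by (simp add: mult_ac)
    finally show ?thesis .
  qed
  have Z2: "Z \<le> Z ^ 2" "Z ^ 2 \<le> Z ^ 3" "1 \<le> Z ^ 3"
    using Z(1) by (auto intro: power_increasing[of 1 2, simplified] power_increasing)
  have La: "real levels * real a \<le> 2 * Z ^ 2"
  proof -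
    have "real levels * real a \<le> (2 * Z) * Z"
      using L Z(1,2) by (intro mult_mono) (auto simp: A_def)
    then show ?thesis by (simp add: power2_eq_square)
  qed
  have LLa: "real levels * (real levels * real a + 2) \<le> 8 * Z ^ 3"
  proof -
    have "real levels * (real levels * real a + 2) \<le> (2 * Z) * (4 * Z ^ 2)"
      using L La Z(1) Z2 by (intro mult_mono) auto
    also have "\<dots> = 8 * Z ^ 3" by (simp add: power2_eq_square power3_eq_cube)
    finally show ?thesis .
  qed
  have S: "real search_steps \<le> 400 * Z ^ 3"
  proof -
    have "real search_steps = 19 + 15 * (real levels + 1) +
        21 * (real levels * (real levels * real a + 2) + (real levels * real a + 2) + 1)"
      by (simp add: search_steps_def algebra_simps)
    moreover have "19 + 15 * (u + 1) + 21 * (w + (v + 2) + 1) \<le> 400 * z3"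
      if "u \<le> 2 * z" "v \<le> 2 * z2" "w \<le> 8 * z3" "z \<le> z2" "z2 \<le> z3" "1 \<le> z3"
      for u v w z z2 z3 :: real
      using that by (simp add: algebra_simps)
    ultimately show ?thesis using L La LLa Z2 by metis
  qed
  have N: "(real levels + 1) * (18 + 7 * real (nblocks levels)) \<le> 96 * Z ^ 3"
  proof -
    have "real (nblocks levels) \<le> real levels * real a"
      using nblocks_le[of levels] by (metis of_nat_le_iff of_nat_mult)
    then have "18 + 7 * real (nblocks levels) \<le> 32 * Z ^ 2"
      using La Z(1) Z2(1) by linarith
    then have "(real levels + 1) * (18 + 7 * real (nblocks levels)) \<le> (3 * Z) * (32 * Z ^ 2)"
      using L Z(1) by (intro mult_mono) auto
    also have "\<dots> = 96 * Z ^ 3" by (simp add: power2_eq_square power3_eq_cube)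
    finally show ?thesis .
  qed
  have P: "real prog_steps \<le> 960 * Z ^ 3"
  proof -
    have "real prog_steps = 37 + (real levels + 1) * (18 + 7 * real (nblocks levels)) + 2 * real search_steps"
      by (simp add: prog_steps_def algebra_simps)
    moreover have "37 + u + 2 * v \<le> 960 * Z ^ 3" if "u \<le> 96 * Z ^ 3" "v \<le> 400 * Z ^ 3" for u v
      using that Z2 by linarith
    ultimately show ?thesis using S N by simp
  qed
  have bl: "real (bit_len bnd) \<le> 13 * Z"
  proof -
    have pos: "bnd > 0" using room_ge(1) by (simp add: bnd_def)
    have "real bnd = 100 * (real (a + 1) * real (a + 1) * real (b + 1) * real (lo + 1) * real (dd + 1))"
      by (simp add: bnd_def room_def power2_eq_square algebra_simps)
    then have "log 2 (real bnd) = log 2 100 + (log 2 (real (a + 1)) + log 2 (real (a + 1)) +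
        log 2 (real (b + 1)) + log 2 (real (lo + 1)) + log 2 (real (dd + 1)))"
      by (simp only: log_mult_pos mult_pos_pos of_nat_0_less_iff zero_less_numeral add_gr_0 zero_less_one simp_thms)
    moreover have "log 2 100 \<le> (7::real)"
    proof -
      have "log 2 100 \<le> log 2 ((2::real) ^ 7)" by (subst log_le_cancel_iff) auto
      also have "\<dots> = 7" by (subst log_pow_cancel) auto
      finally show ?thesis .
    qed
    moreover have "log 2 (real (a + 1)) \<le> A" "log 2 (real (b + 1)) \<le> B"
      using log2_le[of a] log2_le[of b] by (simp_all add: A_def B_def)
    \<comment> \<open>The constant is \<open>1\<close> for rounding in \<open>bit_len\<close> plus
      \<open>7\<close> for the factor 100 in \<open>bnd\<close>.\<close>
    ultimately have "real (bit_len bnd) \<le> 8 + 2 * A + B + 2 * W"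
      using bit_len_le_log[OF pos] logs' by linarith
    then show ?thesis using Z by linarith
  qed
  have "real (prog_steps * (8 * bit_len bnd)) = real prog_steps * (8 * real (bit_len bnd))"
    by simp
  also have "\<dots> \<le> (960 * Z ^ 3) * (8 * (13 * Z))"
    using P bl Z2 Z(1) by (intro mult_mono) auto
  also have "\<dots> = 99840 * Z ^ 4"
    by (simp add: power3_eq_cube power4_eq_xxxx)
  also have "\<dots> \<le> 100000 * Z ^ 4"
    using Z(1) by (intro mult_right_mono) auto
  finally show ?thesis by (simp add: Z_def A_def B_def W_def)
qed

end

theorem mainTheorem16:
  shows "\<exists>(P :: prog) (D :: nat) (coef :: nat \<Rightarrow> nat \<Rightarrow> nat \<Rightarrow> real).
    \<forall>(a :: nat) (b :: nat) (x :: nat) (y :: nat). a > 0 \<longrightarrow> b > 0 \<longrightarrow>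
      computes_within P [a, b, x, y] (remoteness a b (x, y))
        (poly3 D coef (real a) (real b) (log_size x y))"
proof (intro exI allI impI)
  fix a b x y :: nat
  assume "a > 0" "b > 0"
  \<comment> \<open>The locale describes the sorted position; \<open>remoteness_swap\<close> has
    already been used to relate it to \<open>(x, y)\<close>.\<close>
  then interpret wyt_run a b "min x y" "max x y - min x y"
    by unfold_locales
  have "min x y + (max x y - min x y) = max x y" by simp
  note * = computes_wyt_prog[OF refl this] prog_time_le[OF refl this]
  \<comment> \<open>Expanding the fourth power gives degree \<open>4\<close> in each variable and
    products of binomial coefficients.\<close>
  show "computes_within wyt_prog [a, b, x, y] (remoteness a b (x, y))
      (poly3 4 (\<lambda>i j k. 100000 * real (4 choose i) * real (4 choose j) * real (4 choose k))
        (real a) (real b) (log_size x y))"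
    using * order_trans unfolding computes_within_def poly3_binomial by blast
qed

end
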